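(* Let $a_1,a_2,b_1\in\mathbb C$ satisfy $$a_1,\ a_2,\ b_1,\ a_1-b_1,\ a_2-b_1,\ a_1+a_2-b_1\notin\mathbb Z .$$ Let $\varepsilon$ be a sufficiently small positive real number and $\dot x=\varepsilon$. Put $A_1=e^{2\pi\sqrt{-1}a_1}$, $A_2=e^{2\pi\sqrt{-1}a_2}$, $B_1=e^{2\pi\sqrt{-1}b_1}$, $\lambda=B_1/(A_1A_2)$, $\mathrm v=(1,1)$ (a row vector) and $$H=\begin{pmatrix}1&0\\0&-\dfrac{(A_1-B_1)(A_2-B_1)}{B_1(A_1-1)(A_2-1)}\end{pmatrix}.$$ Then there exists a fundamental system $\mathbf F_2(x)$ (a column vector of two linearly independent solutions) of solutions around $\dot x$ to the hypergeometric differential equation $$\Big[x(1-x)\big(\tfrac{d}{dx}\big)^2+\{b_1-(a_1+a_2+1)x\}\tfrac{d}{dx}-a_1a_2\Big]f(x)=0$$ such that the circuit matrices $M_0$ and $M_1$ of $\mathbf F_2(x)$ along the loops $\rho_0$ and $\rho_1$ are $$M_0=\begin{pmatrix}1&0\\0&B_1^{-1}\end{pmatrix},\qquad M_1=\mathrm{id}_2-\frac{1-\lambda}{\mathrm v H\,{}^t\mathrm v}\,H\,{}^t\mathrm v\,\mathrm v .$$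
   Context: $X=\mathbb C\setminus\{0,1\}$ with base point $\dot x=\varepsilon$. The loops are $\rho_0:[0,1]\ni t\mapsto \varepsilon e^{2\pi\sqrt{-1}t}\in X$ and $\rho_1:[0,1]\ni t\mapsto 1-(1-\varepsilon)e^{2\pi\sqrt{-1}t}\in X$. The circuit matrix along a loop $\rho$ based at $\dot x$, with respect to a column vector $\mathbf F(x)$ of linearly independent solutions around $\dot x$ spanning the solution space, is the invertible matrix $M_\rho$ such that the analytic continuation of $\mathbf F(x)$ along $\rho$ equals $M_\rho\mathbf F(x)$ around $\dot x$. $\mathrm{id}_m$ is the identity matrix of size $m$, and ${}^t$ denotes transpose; $H\,{}^t\mathrm v\,\mathrm v$ is the product of the column vector $H\,{}^t\mathrm v$ and the row vector $\mathrm v$. *)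

theory Defs
  imports "HOL-Complex_Analysis.Complex_Analysis"
begin

section \<open>Analytic continuation along a path\<close>

text \<open>
  Germs are represented by functions \<^term>\<open>f :: complex \<Rightarrow> complex\<close> of which only the values near
  the point in question matter. The germ of \<open>g\<close> at the end of \<open>\<gamma>\<close> is the analytic continuation
  along \<open>\<gamma>\<close> of the germ of \<open>f\<close> at its start if both are joined by a family of function elements
  \<open>(G t, D t)\<close>, \<open>t \<in> [0,1]\<close>, such that for \<open>s\<close> close to \<open>t\<close> the point \<open>\<gamma> s\<close> lies in \<open>D t\<close> and
  \<open>G s\<close>, \<open>G t\<close> have the same germ at \<open>\<gamma> s\<close>.
\<close>

definition analytic_continuation_along ::
    "(real \<Rightarrow> complex) \<Rightarrow> (complex \<Rightarrow> complex) \<Rightarrow> (complex \<Rightarrow> complex) \<Rightarrow> bool" where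
  "analytic_continuation_along \<gamma> f g \<longleftrightarrow>
     (\<exists>(G :: real \<Rightarrow> complex \<Rightarrow> complex) (D :: real \<Rightarrow> complex set).
        (\<forall>t\<in>{0..1}. open (D t) \<and> connected (D t) \<and> \<gamma> t \<in> D t \<and> G t holomorphic_on D t) \<and>
        (\<forall>t\<in>{0..1}. \<exists>\<delta>>0. \<forall>s\<in>{0..1}. \<bar>s - t\<bar> < \<delta> \<longrightarrow>
            \<gamma> s \<in> D t \<and> (\<forall>\<^sub>F x in nhds (\<gamma> s). G s x = G t x)) \<and>
        (\<forall>\<^sub>F x in nhds (\<gamma> 0). G 0 x = f x) \<and>
        (\<forall>\<^sub>F x in nhds (\<gamma> 1). G 1 x = g x))"


section \<open>Local solutions of linear differential equations\<close>

text \<open>In the following, \<open>L\<close> is a linear differential operator and the equation is \<open>L f = 0\<close>.\<close>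

definition solution_around ::
    "((complex \<Rightarrow> complex) \<Rightarrow> complex \<Rightarrow> complex) \<Rightarrow> complex \<Rightarrow> (complex \<Rightarrow> complex) \<Rightarrow> bool" where
  "solution_around L p f \<longleftrightarrow>
     (\<exists>U. open U \<and> p \<in> U \<and> f holomorphic_on U \<and> (\<forall>x\<in>U. L f x = 0))"

text \<open>
  The components of \<open>F\<close> form a basis of the space of germs at \<open>p\<close> of solutions: they are solutions,
  linearly independent over the complex numbers, and they span.
\<close>

definition fundamental_system_around ::
    "((complex \<Rightarrow> complex) \<Rightarrow> complex \<Rightarrow> complex) \<Rightarrow> complex \<Rightarrow> (complex \<Rightarrow> complex ^ 'n) \<Rightarrow> bool" where
  "fundamental_system_around L p F \<longleftrightarrow>
     (\<forall>i. solution_around L p (\<lambda>x. F x $ i)) \<and>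
     (\<forall>c :: complex ^ 'n. (\<forall>\<^sub>F x in nhds p. (\<Sum>i\<in>UNIV. c $ i * F x $ i) = 0) \<longrightarrow> c = 0) \<and>
     (\<forall>f. solution_around L p f \<longrightarrow>
        (\<exists>c :: complex ^ 'n. \<forall>\<^sub>F x in nhds p. f x = (\<Sum>i\<in>UNIV. c $ i * F x $ i)))"

definition hypergeometric_operator ::
    "complex \<Rightarrow> complex \<Rightarrow> complex \<Rightarrow> (complex \<Rightarrow> complex) \<Rightarrow> complex \<Rightarrow> complex" where
  "hypergeometric_operator a1 a2 b1 f x =
     x * (1 - x) * deriv (deriv f) x + (b1 - (a1 + a2 + 1) * x) * deriv f x - a1 * a2 * f x"


section \<open>Circuit matrices\<close>

definition loop_in :: "complex set \<Rightarrow> complex \<Rightarrow> (real \<Rightarrow> complex) \<Rightarrow> bool" where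
  "loop_in X p \<gamma> \<longleftrightarrow> path \<gamma> \<and> path_image \<gamma> \<subseteq> X \<and> pathstart \<gamma> = p \<and> pathfinish \<gamma> = p"

text \<open>
  \<open>M\<close> is the circuit matrix along the loop \<open>\<gamma>\<close> in \<open>X\<close> based at \<open>p\<close> with respect to \<open>F\<close>. It is unique
  since the components of \<open>F\<close> are linearly independent.
\<close>

definition is_circuit_matrix ::
    "complex set \<Rightarrow> complex \<Rightarrow> (complex \<Rightarrow> complex ^ 'n) \<Rightarrow> (real \<Rightarrow> complex) \<Rightarrow> complex ^ 'n ^ 'n \<Rightarrow> bool"
  where
  "is_circuit_matrix X p F \<gamma> M \<longleftrightarrow>
     loop_in X p \<gamma> \<and> invertible M \<and>
     (\<forall>i. analytic_continuation_along \<gamma> (\<lambda>x. F x $ i) (\<lambda>x. (M *v F x) $ i))"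

definition rho0 :: "real \<Rightarrow> real \<Rightarrow> complex" where
  "rho0 \<epsilon> t = of_real \<epsilon> * exp (2 * of_real pi * \<i> * of_real t)"

definition rho1 :: "real \<Rightarrow> real \<Rightarrow> complex" where
  "rho1 \<epsilon> t = 1 - (1 - of_real \<epsilon>) * exp (2 * of_real pi * \<i> * of_real t)"

end

theory Submission
  imports Defs
begin

text \<open>
  The monodromy is rigid. Near each of 0 and 1 there are two solutions of the form (power) times
  (power series), so \<open>M\<^sub>0\<close> and \<open>M\<^sub>1\<close> have the eigenvalues \<open>1, 1/B\<^sub>1\<close> and \<open>1, \<lambda>\<close>. At infinity one solution
  of the form \<open>x\<^sup>-\<^sup>a\<close> times a power series in \<open>1/x\<close>, with \<open>a = a\<^sub>1\<close> or \<open>a = a\<^sub>2\<close>, gives the eigenvalue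
  \<open>exp (- 2 \<pi> \<i> a)\<close> of the product; the other one follows from the determinant. In an eigenbasis of
  \<open>M\<^sub>0\<close> these data determine the diagonal entries of \<open>M\<^sub>1\<close> and the product of the off-diagonal ones, which
  is not 0, and a rescaling of the second basis vector brings \<open>M\<^sub>1\<close> to the required form.

  All local solutions extend to the upper and the lower half-plane joined through one of the intervals
  \<open>(-\<infinity>, 0)\<close>, \<open>(0, 1)\<close>, \<open>(1, \<infinity>)\<close>, since these domains are starlike and a linear differential equation
  is solvable on starlike domains. A circuit then amounts to crossing two of the intervals.
\<close>

section \<open>Second-order linear equations on starlike domains\<close>

text \<open>Connection coefficients, and with them Gamma functions, never appear. In an eigenbasis
  of \<open>M0\<close> the matrix \<open>M1\<close> is only defined up to conjugation by diagonal
  matrices, which leaves exactly \<open>m11\<close>, \<open>m22\<close> and \<open>m12 * m21\<close>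
  invariant. The traces of \<open>M1\<close> and \<open>M0 * M1\<close> are two linear equations for
  \<open>m11\<close> and \<open>m22\<close>, independent because \<open>B1\<close> is not 1; the
  determinant of \<open>M1\<close> then gives \<open>m12 * m21\<close>. With \<open>h\<close> the
  second entry of \<open>H\<close> and \<open>p = (1 - lam) / (1 + h)\<close> the result is
  \<open>1 - p\<close>, \<open>1 - h * p\<close> and \<open>h * p * p\<close>, and the integrality
  assumptions keep \<open>h\<close> and \<open>p\<close> away from 0.

  Orientation: the base point lies in the interval from 0 to 1, \<open>rho0\<close> leaves it
  upwards and \<open>rho1\<close> downwards. Hence \<open>M0\<close> is read off from a crossing
  from the upper to the lower half-plane and \<open>M1\<close> from one in the opposite direction.
  Performed one after the other, the two crossings form a positive circuit around 0 and 1 together,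
  to which the solution at infinity applies.\<close>

text \<open>Inductive step of a factorial bound. On the segment from \<open>p\<close> the distance
  to \<open>p\<close> grows linearly, so integrating its \<open>n\<close>-th power along the segment
  produces the missing factor \<open>1 / (n + 1)\<close>; \<open>g\<close> is the primitive of the
  majorant.\<close>

lemma radial_primitive_bound:
  fixes \<phi> \<phi>' :: "complex \<Rightarrow> complex"
  assumes seg: "closed_segment p z \<subseteq> T"
    and der: "\<And>w. w \<in> T \<Longrightarrow> (\<phi> has_field_derivative \<phi>' w) (at w)"
    and "\<phi> p = 0"
    and bnd: "\<And>w. w \<in> T \<Longrightarrow> norm (\<phi>' w) \<le> C * M * (M * norm (w - p)) ^ n / fact n"
  shows "norm (\<phi> z) \<le> C * (M * norm (z - p)) ^ Suc n / fact (Suc n)"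
proof -
  define r where "r = norm (z - p)"
  define \<gamma> where "\<gamma> = (\<lambda>t::real. p + of_real t * (z - p))"
  have mem: "\<gamma> t \<in> T" if "t \<in> {0..1}" for t
  proof -
    have "\<gamma> t = (1 - t) *\<^sub>R p + t *\<^sub>R z" by (simp add: \<gamma>_def algebra_simps scaleR_conv_of_real)
    then show ?thesis using seg that by (auto simp: closed_segment_def)
  qed
  have d1: "((\<lambda>t. \<phi> (\<gamma> t)) has_vector_derivative \<phi>' (\<gamma> t) * (z - p)) (at t)" if "t \<in> {0..1}" for t
  proof -
    have "(\<gamma> has_vector_derivative (z - p)) (at t)"
      unfolding \<gamma>_def has_vector_derivative_def
      by (auto intro!: derivative_eq_intros simp: scaleR_conv_of_real)
    from field_vector_diff_chain_at[OF this der[OF mem[OF that]]] show ?thesis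
      by (simp add: o_def mult.commute)
  qed
  define g where "g = (\<lambda>t::real. C * (M * r * t) ^ Suc n / fact (Suc n))"
  have d2: "(g has_vector_derivative C * (M * r) * (M * r * t) ^ n / fact n) (at t)" for t
  proof -
    have "(g has_real_derivative C * (real (Suc n) * (M * r * t) ^ n * (M * r)) / fact (Suc n)) (at t)"
      unfolding g_def by (auto intro!: derivative_eq_intros simp del: power_Suc fact_Suc)
    moreover have "C * (real (Suc n) * (M * r * t) ^ n * (M * r)) / fact (Suc n)
        = C * (M * r) * (M * r * t) ^ n * (real (Suc n) / fact (Suc n))"
      by (simp only: times_divide_eq_right times_divide_eq_left mult_ac)
    moreover have "real (Suc n) / fact (Suc n) = (1 :: real) / fact n"
      by (simp add: divide_simps del: of_nat_Suc)
    ultimately show ?thesis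
      by (simp add: has_real_derivative_iff_has_vector_derivative del: of_nat_Suc fact_Suc)
  qed
  have "norm (\<phi> (\<gamma> 1) - \<phi> (\<gamma> 0)) \<le> g 1 - g 0"
  proof (rule differentiable_bound_general[where f = "\<lambda>t. \<phi> (\<gamma> t)" and f' = "\<lambda>t. \<phi>' (\<gamma> t) * (z - p)"
        and \<phi>' = "\<lambda>t. C * (M * r) * (M * r * t) ^ n / fact n"])
    show "continuous_on {0..1} (\<lambda>t. \<phi> (\<gamma> t))"
      using d1 by (meson continuous_at_imp_continuous_on has_vector_derivative_continuous)
    show "continuous_on {0..1} g"
      using d2 by (meson continuous_at_imp_continuous_on has_vector_derivative_continuous)
    fix t :: real assume t: "0 < t" "t < 1"
    show "((\<lambda>t. \<phi> (\<gamma> t)) has_vector_derivative \<phi>' (\<gamma> t) * (z - p)) (at t)"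
      using d1 t by simp
    show "(g has_vector_derivative C * (M * r) * (M * r * t) ^ n / fact n) (at t)" by (rule d2)
    have "norm (\<gamma> t - p) = t * r" using t by (simp add: \<gamma>_def r_def norm_mult)
    then have "norm (\<phi>' (\<gamma> t)) * r \<le> (C * M * (M * (t * r)) ^ n / fact n) * r"
      using bnd[OF mem[of t]] t by (intro mult_right_mono) (auto simp: r_def)
    then show "norm (\<phi>' (\<gamma> t) * (z - p)) \<le> C * (M * r) * (M * r * t) ^ n / fact n"
      by (simp add: norm_mult r_def mult_ac)
  qed simp
  then show ?thesis using assms(3) by (simp add: \<gamma>_def g_def r_def)
qed

lemma compact_segment_union:
  fixes p :: "'a::real_normed_vector"
  assumes "compact K"
  shows "compact (\<Union>x\<in>K. closed_segment p x)"
proof -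
  have "(\<Union>x\<in>K. closed_segment p x) = (\<lambda>(t, x). (1 - t) *\<^sub>R p + t *\<^sub>R x) ` ({0..1} \<times> K)"
    by (fastforce simp: closed_segment_def)
  moreover have "compact \<dots>"
    by (intro compact_continuous_image compact_Times assms)
       (auto intro!: continuous_intros simp: case_prod_beta)
  ultimately show ?thesis by simp
qed

text \<open>Picard iteration for the system u' = v, v' = P v + Q u. On a starlike domain holomorphic
  functions have primitives, these can be estimated along segments from \<open>p\<close>, and the
  resulting factorials give locally uniform convergence on all of \<open>S\<close>.\<close>

proposition linear_ode2_exists:
  fixes P Q :: "complex \<Rightarrow> complex"
  assumes "open S" and "p \<in> S" and star: "\<And>z. z \<in> S \<Longrightarrow> closed_segment p z \<subseteq> S"
    and P: "P holomorphic_on S" and Q: "Q holomorphic_on S"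
  obtains u v where "u p = c0" and "v p = c1"
    and "\<And>z. z \<in> S \<Longrightarrow> (u has_field_derivative v z) (at z)"
    and "\<And>z. z \<in> S \<Longrightarrow> (v has_field_derivative P z * v z + Q z * u z) (at z)"
proof -
  have sl: "starlike S" using assms(2) star by (auto simp: starlike_def)
  have "\<exists>g. (\<forall>z\<in>S. (g has_field_derivative \<phi> z) (at z)) \<and> g p = 0"
    if hol: "\<phi> holomorphic_on S" for \<phi>
  proof -
    obtain g where "\<forall>z\<in>S. (g has_field_derivative \<phi> z) (at z)"
      using holomorphic_starlike_primitive[OF holomorphic_on_imp_continuous_on[OF hol] sl \<open>open S\<close>
          finite.emptyI] hol \<open>open S\<close> by (metis Diff_empty holomorphic_on_imp_differentiable_at)
    then show ?thesis
      by (intro exI[of _ "\<lambda>z. g z - g p"]) (auto intro!: derivative_eq_intros)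
  qed
  then obtain J where J: "\<And>\<phi> z. \<phi> holomorphic_on S \<Longrightarrow> z \<in> S \<Longrightarrow> (J \<phi> has_field_derivative \<phi> z) (at z)"
    and J0: "\<And>\<phi>. \<phi> holomorphic_on S \<Longrightarrow> J \<phi> p = 0"
    by metis
  \<comment> \<open>\<open>W n\<close> is the \<open>n\<close>-th increment of the iteration, not
    the \<open>n\<close>-th approximation: the solution is the sum of all increments. The initial
    values enter through \<open>W 0\<close> alone, since the primitives chosen by \<open>J\<close>
    vanish at \<open>p\<close>.\<close>
  define W where "W n = ((\<lambda>(u, v). (J v, J (\<lambda>z. P z * v z + Q z * u z))) ^^ n)
      ((\<lambda>_. c0), (\<lambda>_. c1))" for n
  define U where "U n = fst (W n)" for n
  define V where "V n = snd (W n)" for n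
  have U0: "U 0 = (\<lambda>_. c0)" "V 0 = (\<lambda>_. c1)" by (simp_all add: U_def V_def W_def)
  have US: "U (Suc n) = J (V n)" and VS: "V (Suc n) = J (\<lambda>z. P z * V n z + Q z * U n z)" for n
    by (simp_all add: U_def V_def W_def case_prod_beta)
  have hol: "U n holomorphic_on S \<and> V n holomorphic_on S" for n
  proof (induction n)
    case (Suc n)
    then have "(\<lambda>z. P z * V n z + Q z * U n z) holomorphic_on S"
      using P Q by (intro holomorphic_intros) auto
    with Suc J show ?case
      unfolding US VS holomorphic_on_open[OF \<open>open S\<close>] by blast
  qed (auto simp: U0)
  have hPQ: "(\<lambda>z. P z * V n z + Q z * U n z) holomorphic_on S" for n
    using P Q hol[of n] by (intro holomorphic_intros) auto
  have dU: "(U (Suc n) has_field_derivative V n z) (at z)"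
    and dV: "(V (Suc n) has_field_derivative P z * V n z + Q z * U n z) (at z)"
    and Z: "U (Suc n) p = 0" "V (Suc n) p = 0" if "z \<in> S" for n z
    using that hol[of n] hPQ[of n] unfolding US VS by (auto intro: J J0)
  have main: "((\<lambda>z. \<Sum>n. U n z) has_field_derivative (\<Sum>n. V n z)) (at z) \<and>
      ((\<lambda>z. \<Sum>n. V n z) has_field_derivative P z * (\<Sum>n. V n z) + Q z * (\<Sum>n. U n z)) (at z)"
    if z: "z \<in> S" for z
  proof -
    obtain r where r: "r > 0" "cball z r \<subseteq> S" using \<open>open S\<close> z open_contains_cball by blast
    \<comment> \<open>The estimate at a point near \<open>z\<close> requires bounds along its whole
      segment from \<open>p\<close>. The union \<open>T\<close> of these segments is compact, so
      \<open>P\<close> and \<open>Q\<close> are bounded on it, and with each point it contains the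
      segment from \<open>p\<close> to that point.\<close>
    define T where "T = (\<Union>x\<in>cball z r. closed_segment p x)"
    have T: "compact T" "T \<subseteq> S" "cball z r \<subseteq> T"
      using star r unfolding T_def by (auto intro: compact_segment_union)
    have Tst: "closed_segment p x \<subseteq> T" if x: "x \<in> T" for x
    proof -
      obtain y where y: "y \<in> cball z r" "x \<in> closed_segment p y" using x by (auto simp: T_def)
      then have "closed_segment p x \<subseteq> closed_segment p y"
        by (intro closed_segment_subset) auto
      then show ?thesis using y(1) unfolding T_def by blast
    qed
    have "compact ((\<lambda>z. norm (P z) + norm (Q z)) ` T)"
      using P Q T by (intro compact_continuous_image continuous_intros)
         (auto dest: holomorphic_on_imp_continuous_on intro: continuous_on_subset)
    then have "bdd_above ((\<lambda>z. norm (P z) + norm (Q z)) ` T)"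
      by (intro bounded_imp_bdd_above compact_imp_bounded)
    then obtain M0 where M0: "\<And>x. x \<in> T \<Longrightarrow> norm (P x) + norm (Q x) \<le> M0"
      unfolding bdd_above_def by auto
    \<comment> \<open>The lower bound 1 accounts for the coefficient 1 in u' = v, so that a single
      constant serves both components.\<close>
    define M where "M = max 1 M0"
    define C where "C = max (norm c0) (norm c1)"
    have M: "M \<ge> 1" "norm (P x) + norm (Q x) \<le> M" if "x \<in> T" for x
      using M0[OF that] by (auto simp: M_def)
    have C: "C \<ge> 0" by (auto simp: C_def le_max_iff_disj)
    have bd: "\<forall>x\<in>T. norm (U n x) \<le> C * (M * norm (x - p)) ^ n / fact n \<and>
        norm (V n x) \<le> C * (M * norm (x - p)) ^ n / fact n" for n
    proof (induction n)
      case 0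
      then show ?case by (simp add: U0 C_def)
    next
      case (Suc n)
      define b where "b x = C * (M * norm (x - p)) ^ n / fact n" for x
      have b: "b x \<ge> 0" "M \<ge> 1" for x using C by (auto simp: b_def M_def)
      have 1: "norm (V n x) \<le> C * M * (M * norm (x - p)) ^ n / fact n" if "x \<in> T" for x
      proof -
        have "norm (V n x) \<le> b x" using Suc that by (auto simp: b_def)
        also have "\<dots> \<le> M * b x" using b(1)[of x] b(2) by (simp add: mult_le_cancel_right1)
        finally show ?thesis by (simp add: b_def mult_ac)
      qed
      have 2: "norm (P x * V n x + Q x * U n x) \<le> C * M * (M * norm (x - p)) ^ n / fact n"
        if "x \<in> T" for x
      proof -
        have "norm (P x * V n x + Q x * U n x) \<le> norm (P x) * b x + norm (Q x) * b x"
          using Suc that unfolding norm_mult b_def[symmetric]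
          by (intro norm_triangle_le add_mono) (simp_all add: norm_mult mult_left_mono)
        also have "\<dots> = (norm (P x) + norm (Q x)) * b x" by (simp add: algebra_simps)
        also have "\<dots> \<le> M * b x" using M that b by (intro mult_right_mono) auto
        finally show ?thesis by (simp add: b_def mult_ac)
      qed
      show ?case
      proof (intro ballI conjI)
        fix x assume x: "x \<in> T"
        show "norm (U (Suc n) x) \<le> C * (M * norm (x - p)) ^ Suc n / fact (Suc n)"
          by (rule radial_primitive_bound[OF Tst[OF x] dU Z(1) 1]) (use T x \<open>p \<in> S\<close> in auto)
        show "norm (V (Suc n) x) \<le> C * (M * norm (x - p)) ^ Suc n / fact (Suc n)"
          by (rule radial_primitive_bound[OF Tst[OF x] dV Z(2) 2]) (use T x \<open>p \<in> S\<close> in auto)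
      qed
    qed
    define R where "R = M * (norm (z - p) + r)"
    define B where "B n = C * (R ^ n / fact n)" for n
    have R: "M * norm (x - p) \<le> R" if "x \<in> cball z r" for x
    proof -
      have "norm (x - p) \<le> norm (z - p) + r"
        using that norm_triangle_ineq[of "z - p" "x - z"] by (simp add: dist_norm norm_minus_commute)
      then show ?thesis unfolding R_def M_def by (intro mult_left_mono) auto
    qed
    have bd': "norm (U n x) \<le> B n" "norm (V n x) \<le> B n" if "x \<in> cball z r" for n x
    proof -
      have "C * (M * norm (x - p)) ^ n / fact n \<le> B n"
        unfolding B_def times_divide_eq_right[symmetric]
        using R[OF that] C by (intro mult_left_mono divide_right_mono power_mono) (auto simp: M_def)
      moreover have "x \<in> T" using T that by blast
      ultimately show "norm (U n x) \<le> B n" "norm (V n x) \<le> B n"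
        using bd[of n] order_trans by blast+
    qed
    have sB: "summable B"
      unfolding B_def using summable_exp[of R] by (intro summable_mult) (simp add: field_simps)
    have sU: "summable (\<lambda>n. U n x)" and sV: "summable (\<lambda>n. V n x)" if "x \<in> cball z r" for x
      using bd'[OF that] sB by (auto intro: summable_comparison_test)
    \<comment> \<open>Termwise differentiation shifts the index: the derivative of term
      \<open>n\<close> involves the terms of index \<open>n - 1\<close>, and the constant term of
      index 0 contributes 0.\<close>
    define dU' where "dU' n x = (case n of 0 \<Rightarrow> 0 | Suc m \<Rightarrow> V m x)" for n x
    define dV' where "dV' n x = (case n of 0 \<Rightarrow> 0 | Suc m \<Rightarrow> P x * V m x + Q x * U m x)" for n x
    have unif_shift: "uniformly_convergent_on (cball z r) (\<lambda>n x. \<Sum>i<n. case i of 0 \<Rightarrow> 0 | Suc m \<Rightarrow> F m x)"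
      if "\<And>n x. x \<in> cball z r \<Longrightarrow> norm (F n x) \<le> K * B n" for F :: "nat \<Rightarrow> complex \<Rightarrow> complex" and K
    proof (rule Weierstrass_m_test')
      show "norm (case n of 0 \<Rightarrow> 0 | Suc m \<Rightarrow> F m x) \<le> (case n of 0 \<Rightarrow> 0 | Suc m \<Rightarrow> K * B m)"
        if "x \<in> cball z r" for n x
        using \<open>\<And>n x. x \<in> cball z r \<Longrightarrow> norm (F n x) \<le> K * B n\<close>[OF that] by (auto split: nat.split)
      have "summable (\<lambda>n. case Suc n of 0 \<Rightarrow> 0 | Suc m \<Rightarrow> K * B m)"
        by (simp add: summable_mult sB)
      then show "summable (\<lambda>n. case n of 0 \<Rightarrow> 0 | Suc m \<Rightarrow> K * B m)"
        by (subst (asm) summable_Suc_iff)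
    qed
    have zc: "z \<in> cball z r" "z \<in> interior (cball z r)" using r by auto
    have sumS: "(\<Sum>n. case n of 0 \<Rightarrow> 0 | Suc m \<Rightarrow> f m) = suminf f" if "summable f" for f :: "nat \<Rightarrow> complex"
    proof -
      have "summable (\<lambda>n. case n of 0 \<Rightarrow> 0 | Suc m \<Rightarrow> f m)"
        using that by (subst summable_Suc_iff[symmetric]) simp
      from suminf_split_head[OF this] show ?thesis by simp
    qed
    have dU1: "(U n has_field_derivative dU' n x) (at x within cball z r)"
      and dV1: "(V n has_field_derivative dV' n x) (at x within cball z r)" if "x \<in> cball z r" for n x
    proof -
      have "(U n has_field_derivative dU' n x) (at x)" "(V n has_field_derivative dV' n x) (at x)"
        using that dU[of x] dV[of x] r by (cases n; auto simp: U0 dU'_def dV'_def)+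
      then show "(U n has_field_derivative dU' n x) (at x within cball z r)"
        "(V n has_field_derivative dV' n x) (at x within cball z r)"
        by (simp_all add: has_field_derivative_at_within)
    qed
    have unifU: "uniformly_convergent_on (cball z r) (\<lambda>n x. \<Sum>i<n. dU' i x)"
      unfolding dU'_def by (rule unif_shift[where K = 1]) (use bd' in auto)
    have unifV: "uniformly_convergent_on (cball z r) (\<lambda>n x. \<Sum>i<n. dV' i x)"
      unfolding dV'_def
    proof (rule unif_shift[where K = M])
      fix n x assume x: "x \<in> cball z r"
      have "norm (P x * V n x + Q x * U n x) \<le> norm (P x) * B n + norm (Q x) * B n"
        using bd'[OF x] by (intro norm_triangle_le add_mono) (auto simp: norm_mult intro!: mult_left_mono)
      also have "\<dots> = (norm (P x) + norm (Q x)) * B n" by (simp add: algebra_simps)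
      also have "\<dots> \<le> M * B n"
      proof (rule mult_right_mono)
        show "norm (P x) + norm (Q x) \<le> M" using M(2)[of x] T x by blast
        show "0 \<le> B n" using bd'(1)[OF x, of n] norm_ge_zero order_trans by blast
      qed
      finally show "norm (P x * V n x + Q x * U n x) \<le> M * B n" .
    qed
    have "(\<Sum>n. dU' n z) = (\<Sum>n. V n z)"
      unfolding dU'_def by (rule sumS[OF sV[OF zc(1)]])
    moreover have "(\<Sum>n. dV' n z) = P z * (\<Sum>n. V n z) + Q z * (\<Sum>n. U n z)"
    proof -
      have "(\<Sum>n. dV' n z) = (\<Sum>n. P z * V n z + Q z * U n z)"
        unfolding dV'_def by (intro sumS summable_add summable_mult sU sV zc(1))
      also have "\<dots> = P z * (\<Sum>n. V n z) + Q z * (\<Sum>n. U n z)"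
        using sU[OF zc(1)] sV[OF zc(1)] by (simp add: suminf_add[symmetric] suminf_mult summable_mult)
      finally show ?thesis .
    qed
    moreover note has_field_derivative_series'(2)[where f = U and f' = dU',
        OF convex_cball dU1 unifU zc(1) sU[OF zc(1)] zc(2)]
      has_field_derivative_series'(2)[where f = V and f' = dV',
        OF convex_cball dV1 unifV zc(1) sV[OF zc(1)] zc(2)]
    ultimately show ?thesis by simp
  qed
  have "(\<Sum>n. U n p) = c0" "(\<Sum>n. V n p) = c1"
  proof -
    have "U n p = 0" "V n p = 0" if "n \<notin> {0}" for n
      using Z[OF \<open>p \<in> S\<close>] that by (cases n; simp)+
    then have "(\<lambda>n. U n p) sums (\<Sum>n\<in>{0}. U n p)" "(\<lambda>n. V n p) sums (\<Sum>n\<in>{0}. V n p)"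
      by (intro sums_finite; simp)+
    then show "(\<Sum>n. U n p) = c0" "(\<Sum>n. V n p) = c1" by (auto simp: U0 sums_iff)
  qed
  then show ?thesis using main that[of "\<lambda>z. \<Sum>n. U n z" "\<lambda>z. \<Sum>n. V n z"] by blast
qed

text \<open>Differentiating the equation by the Leibniz rule expresses each higher derivative of
  \<open>f\<close> at \<open>p\<close> through lower ones, so all of them vanish, and the identity
  theorem applies.\<close>

proposition linear_ode2_unique:
  fixes P Q f :: "complex \<Rightarrow> complex"
  assumes "open S" and "connected S" and "p \<in> S"
    and P: "P holomorphic_on S" and Q: "Q holomorphic_on S" and f: "f holomorphic_on S"
    and ode: "\<And>z. z \<in> S \<Longrightarrow> deriv (deriv f) z = P z * deriv f z + Q z * f z"
    and "f p = 0" and "deriv f p = 0" and "z \<in> S"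
  shows "f z = 0"
proof -
  have "(deriv ^^ n) f p = 0" for n
  proof (induction n rule: less_induct)
    case (less n)
    consider "n = 0" | "n = 1" | k where "n = Suc (Suc k)"
      by (metis One_nat_def not0_implies_Suc)
    then show ?case
    proof cases
      case 3
      have IH: "(deriv ^^ j) f p = 0" if "j \<le> Suc k" for j using less.IH[of j] 3 that by simp
      have h1: "deriv f holomorphic_on S" using f \<open>open S\<close> by (rule holomorphic_deriv)
      have h2: "(\<lambda>z. P z * deriv f z) holomorphic_on S" "(\<lambda>z. Q z * f z) holomorphic_on S"
        using P Q f h1 by (auto intro!: holomorphic_intros)
      have "(deriv ^^ n) f p = (deriv ^^ k) (deriv (deriv f)) p"
        unfolding 3 by (simp del: funpow.simps add: funpow_Suc_right)
      also have "\<dots> = (deriv ^^ k) (\<lambda>z. P z * deriv f z + Q z * f z) p"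
        by (rule higher_deriv_transform_within_open[OF _ _ \<open>open S\<close> \<open>p \<in> S\<close> ode])
           (use h1 h2 \<open>open S\<close> in \<open>auto intro: holomorphic_intros holomorphic_deriv\<close>)
      also have "\<dots> = (deriv ^^ k) (\<lambda>z. P z * deriv f z) p + (deriv ^^ k) (\<lambda>z. Q z * f z) p"
        by (rule higher_deriv_add[OF h2 \<open>open S\<close> \<open>p \<in> S\<close>])
      also have "(deriv ^^ k) (\<lambda>z. Q z * f z) p = 0"
        by (subst higher_deriv_mult[OF Q f \<open>open S\<close> \<open>p \<in> S\<close>]) (simp add: IH)
      also have "(deriv ^^ k) (\<lambda>z. P z * deriv f z) p = 0"
      proof (subst higher_deriv_mult[OF P h1 \<open>open S\<close> \<open>p \<in> S\<close>], rule sum.neutral, rule ballI)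
        fix i assume "i \<in> {0..k}"
        have "(deriv ^^ (k - i)) (deriv f) p = (deriv ^^ Suc (k - i)) f p"
          by (simp del: funpow.simps add: funpow_Suc_right)
        then show "of_nat (k choose i) * (deriv ^^ i) P p * (deriv ^^ (k - i)) (deriv f) p = 0"
          using IH[of "Suc (k - i)"] by simp
      qed
      finally show ?thesis by simp
    qed (use assms in auto)
  qed
  then show ?thesis
    using holomorphic_fun_eq_0_on_connected[OF f \<open>open S\<close> \<open>connected S\<close> _ \<open>p \<in> S\<close> \<open>z \<in> S\<close>] by blast
qed

section \<open>The hypergeometric equation\<close>

definition hg_solution :: "complex \<Rightarrow> complex \<Rightarrow> complex \<Rightarrow> complex set \<Rightarrow> (complex \<Rightarrow> complex) \<Rightarrow> bool" where
  "hg_solution a b c S f \<longleftrightarrow>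
     f holomorphic_on S \<and> (\<forall>x\<in>S. hypergeometric_operator a b c f x = 0)"

lemma hg_solutionI:
  assumes "open S"
    and f: "\<And>x. x \<in> S \<Longrightarrow> (f has_field_derivative f' x) (at x)"
    and f': "\<And>x. x \<in> S \<Longrightarrow> (f' has_field_derivative f'' x) (at x)"
    and ode: "\<And>x. x \<in> S \<Longrightarrow> x * (1 - x) * f'' x + (c - (a + b + 1) * x) * f' x - a * b * f x = 0"
  shows "hg_solution a b c S f"
proof -
  have "deriv (deriv f) x = f'' x" if "x \<in> S" for x
  proof -
    have "eventually (\<lambda>y. y \<in> S) (nhds x)" using \<open>open S\<close> that by (rule eventually_nhds_in_open)
    then have "eventually (\<lambda>y. deriv f y = f' y) (nhds x)"
      by eventually_elim (rule DERIV_imp_deriv[OF f])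
    then have "deriv (deriv f) x = deriv f' x" by (rule deriv_cong_ev) simp
    then show ?thesis using DERIV_imp_deriv[OF f'[OF that]] by simp
  qed
  moreover have "deriv f x = f' x" if "x \<in> S" for x using DERIV_imp_deriv[OF f[OF that]] .
  moreover have "f holomorphic_on S" using f by (auto simp: holomorphic_on_open[OF \<open>open S\<close>])
  ultimately show ?thesis using ode by (simp add: hg_solution_def hypergeometric_operator_def)
qed

lemma hg_solutionD:
  assumes "hg_solution a b c S f" and "open S" and "x \<in> S"
  shows "(f has_field_derivative deriv f x) (at x)"
    and "(deriv f has_field_derivative deriv (deriv f) x) (at x)"
    and "x * (1 - x) * deriv (deriv f) x + (c - (a + b + 1) * x) * deriv f x - a * b * f x = 0"
  using assms holomorphic_deriv[of f S]
  by (auto simp: hg_solution_def hypergeometric_operator_def intro: holomorphic_derivI)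

lemma hg_solution_subset: "hg_solution a b c S f \<Longrightarrow> T \<subseteq> S \<Longrightarrow> hg_solution a b c T f"
  by (auto simp: hg_solution_def intro: holomorphic_on_subset)

text \<open>Serves to exchange the two exponents at infinity in the resonant case.\<close>

lemma hg_solution_commute: "hg_solution a b c S f = hg_solution b a c S f"
  by (simp add: hg_solution_def hypergeometric_operator_def algebra_simps)

lemma hg_solution_lincomb:
  assumes "hg_solution a b c S f" "hg_solution a b c S g" "open S"
  shows "hg_solution a b c S (\<lambda>x. k * f x + l * g x)"
proof (rule hg_solutionI[OF \<open>open S\<close>])
  fix x assume x: "x \<in> S"
  note F = hg_solutionD[OF assms(1,3) x] and G = hg_solutionD[OF assms(2,3) x]
  show "((\<lambda>x. k * f x + l * g x) has_field_derivative k * deriv f x + l * deriv g x) (at x)"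
    using F G by (auto intro!: derivative_eq_intros)
  show "((\<lambda>x. k * deriv f x + l * deriv g x) has_field_derivative
      k * deriv (deriv f) x + l * deriv (deriv g) x) (at x)"
    using F G by (auto intro!: derivative_eq_intros)
  have "x * (1 - x) * (k * deriv (deriv f) x + l * deriv (deriv g) x) +
      (c - (a + b + 1) * x) * (k * deriv f x + l * deriv g x) - a * b * (k * f x + l * g x) =
      k * (x * (1 - x) * deriv (deriv f) x + (c - (a + b + 1) * x) * deriv f x - a * b * f x) +
      l * (x * (1 - x) * deriv (deriv g) x + (c - (a + b + 1) * x) * deriv g x - a * b * g x)"
    by (simp add: algebra_simps)
  also have "\<dots> = 0" using F(3) G(3) by simp
  finally show "x * (1 - x) * (k * deriv (deriv f) x + l * deriv (deriv g) x) +
      (c - (a + b + 1) * x) * (k * deriv f x + l * deriv g x) - a * b * (k * f x + l * g x) = 0" .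
qed

lemma hg_solution_cmult:
  assumes "hg_solution a b c S f" "open S"
  shows "hg_solution a b c S (\<lambda>x. k * f x)"
  using hg_solution_lincomb[OF assms(1,1,2), of k 0] by simp

lemma hg_solution_exists:
  assumes "open S" "p \<in> S" "\<And>z. z \<in> S \<Longrightarrow> closed_segment p z \<subseteq> S" "0 \<notin> S" "1 \<notin> S"
  obtains f where "hg_solution a b c S f" "f p = c0" "deriv f p = c1"
proof -
  define P where "P x = - (c - (a + b + 1) * x) / (x * (1 - x))" for x
  define Q where "Q x = a * b / (x * (1 - x))" for x
  have nz: "x \<noteq> 0 \<and> 1 - x \<noteq> 0" if "x \<in> S" for x using that assms by auto
  then have "P holomorphic_on S" "Q holomorphic_on S"
    unfolding P_def Q_def by (auto intro!: holomorphic_intros)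
  from linear_ode2_exists[OF assms(1-3) this, of c0 c1]
  obtain u v where u: "u p = c0" "v p = c1"
    "\<And>z. z \<in> S \<Longrightarrow> (u has_field_derivative v z) (at z)"
    "\<And>z. z \<in> S \<Longrightarrow> (v has_field_derivative P z * v z + Q z * u z) (at z)" by metis
  have "hg_solution a b c S u"
  proof (rule hg_solutionI[OF assms(1) u(3,4)])
    fix x assume "x \<in> S"
    then have "x * (1 - x) * (P x * v x + Q x * u x) = - (c - (a + b + 1) * x) * v x + a * b * u x"
      using nz[of x] by (simp add: P_def Q_def distrib_left)
    then show "x * (1 - x) * (P x * v x + Q x * u x) + (c - (a + b + 1) * x) * v x - a * b * u x = 0"
      by (simp add: algebra_simps)
  qed
  moreover have "deriv u p = c1" using DERIV_imp_deriv[OF u(3)[OF assms(2)]] u(2) by simp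
  ultimately show ?thesis using that u(1) by blast
qed

lemma hg_solution_eq_0:
  assumes f: "hg_solution a b c S f" and S: "open S" "connected S" "p \<in> S" "0 \<notin> S" "1 \<notin> S"
    and "f p = 0" "deriv f p = 0" "x \<in> S"
  shows "f x = 0"
proof -
  define P where "P x = - (c - (a + b + 1) * x) / (x * (1 - x))" for x
  define Q where "Q x = a * b / (x * (1 - x))" for x
  have nz: "x \<noteq> 0 \<and> 1 - x \<noteq> 0" if "x \<in> S" for x using that assms by auto
  then have PQ: "P holomorphic_on S" "Q holomorphic_on S"
    unfolding P_def Q_def by (auto intro!: holomorphic_intros)
  show ?thesis
  proof (rule linear_ode2_unique[OF S(1-3) PQ _ _ assms(7-9)])
    show "f holomorphic_on S" using f by (simp add: hg_solution_def)
    fix z assume z: "z \<in> S"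
    have "z * (1 - z) * deriv (deriv f) z = - (c - (a + b + 1) * z) * deriv f z + a * b * f z"
      using hg_solutionD(3)[OF f S(1) z] by (simp add: algebra_simps)
    also have "\<dots> = z * (1 - z) * (P z * deriv f z + Q z * f z)"
      using nz[OF z] by (simp add: P_def Q_def distrib_left)
    finally show "deriv (deriv f) z = P z * deriv f z + Q z * f z" using nz[OF z] by simp
  qed
qed

lemma hg_solution_eq_open:
  assumes f: "hg_solution a b c S f" "hg_solution a b c S g" and S: "open S" "connected S"
    and U: "open U" "U \<noteq> {}" "U \<subseteq> S" "\<And>x. x \<in> U \<Longrightarrow> f x = g x" and x: "x \<in> S"
  shows "f x = g x"
  by (rule analytic_continuation_open[OF U(1) S(1) U(2) S(2) U(3) _ _ _ x])
     (use f U(4) in \<open>auto simp: hg_solution_def\<close>)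

definition independent_on :: "complex set \<Rightarrow> (complex \<Rightarrow> complex) \<Rightarrow> (complex \<Rightarrow> complex) \<Rightarrow> bool" where
  "independent_on S f g \<longleftrightarrow> (\<forall>k l. (\<forall>x\<in>S. k * f x + l * g x = 0) \<longrightarrow> k = 0 \<and> l = 0)"

text \<open>If the Wronskian \<open>W\<close> vanished at \<open>q\<close>, a nontrivial combination
  would vanish there to first order, hence everywhere on \<open>S\<close>. So Cramer's rule matches
  value and derivative of \<open>u\<close> at \<open>q\<close>, and uniqueness does the rest on
  \<open>U\<close>, which may be a mere half-plane or disc.\<close>

lemma hg_solution_span:
  assumes f: "hg_solution a b c S f1" "hg_solution a b c S f2" and ind: "independent_on S f1 f2"
    and S: "open S" "connected S" "0 \<notin> S" "1 \<notin> S"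
    and U: "open U" "connected U" "U \<noteq> {}" "U \<subseteq> S" and u: "hg_solution a b c U u"
  obtains k l where "\<And>x. x \<in> U \<Longrightarrow> u x = k * f1 x + l * f2 x"
proof -
  obtain q where q: "q \<in> U" "q \<in> S" using U by auto
  define W where "W = f1 q * deriv f2 q - deriv f1 q * f2 q"
  have dlin: "deriv (\<lambda>x. k * f1 x + l * f2 x) q = k * deriv f1 q + l * deriv f2 q" for k l
    using hg_solutionD(1)[OF f(1) S(1) q(2)] hg_solutionD(1)[OF f(2) S(1) q(2)]
    by (intro DERIV_imp_deriv) (auto intro!: derivative_eq_intros)
  have W: "W \<noteq> 0"
  proof
    assume "W = 0"
    have *: "k = 0 \<and> l = 0" if "k * f1 q + l * f2 q = 0" "k * deriv f1 q + l * deriv f2 q = 0" for k l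
    proof -
      have "k * f1 x + l * f2 x = 0" if "x \<in> S" for x
        by (rule hg_solution_eq_0[OF hg_solution_lincomb[OF f S(1)] S(1,2) q(2) S(3,4) _ _ that])
           (use \<open>k * f1 q + l * f2 q = 0\<close> \<open>k * deriv f1 q + l * deriv f2 q = 0\<close> dlin in auto)
      then show ?thesis using ind unfolding independent_on_def by blast
    qed
    \<comment> \<open>Both coefficient pairs lie in the kernel of the singular matrix of values and
      derivatives. Each must be zero, so all four entries vanish, and then the coefficients 1, 1
      give the contradiction.\<close>
    from *[of "- f2 q" "f1 q"] \<open>W = 0\<close> have "f1 q = 0" "f2 q = 0" by (auto simp: W_def algebra_simps)
    moreover from this *[of "- deriv f2 q" "deriv f1 q"] have "deriv f1 q = 0" "deriv f2 q = 0"
      by (auto simp: algebra_simps)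
    ultimately show False using *[of 1 1] by simp
  qed
  define k where "k = (u q * deriv f2 q - deriv u q * f2 q) / W"
  define l where "l = (f1 q * deriv u q - deriv f1 q * u q) / W"
  have kl: "k * f1 q + l * f2 q = u q" "k * deriv f1 q + l * deriv f2 q = deriv u q"
  proof -
    have "k * W = u q * deriv f2 q - deriv u q * f2 q" "l * W = f1 q * deriv u q - deriv f1 q * u q"
      using W by (simp_all add: k_def l_def)
    then have "(k * f1 q + l * f2 q) * W = u q * W" "(k * deriv f1 q + l * deriv f2 q) * W = deriv u q * W"
      using W_def by algebra+
    then show "k * f1 q + l * f2 q = u q" "k * deriv f1 q + l * deriv f2 q = deriv u q"
      using W by auto
  qed
  have sol: "hg_solution a b c U (\<lambda>x. 1 * u x + (- 1) * (k * f1 x + l * f2 x))"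
    by (intro hg_solution_lincomb u U(1) hg_solution_subset[OF f(1) U(4)] hg_solution_subset[OF f(2) U(4)])
  have "((\<lambda>x. 1 * u x + (- 1) * (k * f1 x + l * f2 x)) has_field_derivative
      1 * deriv u q + (- 1) * (k * deriv f1 q + l * deriv f2 q)) (at q)"
    using hg_solutionD(1)[OF f(1) S(1) q(2)] hg_solutionD(1)[OF f(2) S(1) q(2)]
      hg_solutionD(1)[OF u U(1) q(1)]
    by (auto intro!: derivative_eq_intros)
  then have d: "deriv (\<lambda>x. 1 * u x + (- 1) * (k * f1 x + l * f2 x)) q = 0"
    using kl by (auto dest: DERIV_imp_deriv)
  have "1 * u x + (- 1) * (k * f1 x + l * f2 x) = 0" if "x \<in> U" for x
    by (rule hg_solution_eq_0[OF sol U(1,2) q(1) _ _ _ d that]) (use U(4) S kl in auto)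
  then show ?thesis by (intro that[of k l]) (simp add: algebra_simps)
qed

section \<open>Transformations relating the three singular points\<close>

text \<open>The reflection exchanges 0 and 1. With third parameter \<open>a + b + 1 - c\<close> the
  exponents at 0 are 0 and \<open>c - a - b\<close>, those of the original equation at 1.\<close>

lemma hg_solution_reflect:
  assumes u: "hg_solution a b (a + b + 1 - c) T u" and "open S" "open T" and ST: "\<And>x. x \<in> S \<Longrightarrow> 1 - x \<in> T"
  shows "hg_solution a b c S (\<lambda>x. u (1 - x))"
proof (rule hg_solutionI[OF \<open>open S\<close>])
  fix x assume x: "x \<in> S"
  note D = hg_solutionD[OF u \<open>open T\<close> ST[OF x]]
  have i: "((\<lambda>x. 1 - x) has_field_derivative - 1) (at x)" by (auto intro!: derivative_eq_intros)
  show "((\<lambda>x. u (1 - x)) has_field_derivative - deriv u (1 - x)) (at x)"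
    using DERIV_chain2[OF D(1) i] by simp
  have "((\<lambda>x. deriv u (1 - x)) has_field_derivative - deriv (deriv u) (1 - x)) (at x)"
    using DERIV_chain2[OF D(2) i] by simp
  then show "((\<lambda>x. - deriv u (1 - x)) has_field_derivative deriv (deriv u) (1 - x)) (at x)"
    by (auto intro!: derivative_eq_intros)
  show "x * (1 - x) * deriv (deriv u) (1 - x) + (c - (a + b + 1) * x) * - deriv u (1 - x)
      - a * b * u (1 - x) = 0"
    using D(3) by (simp add: algebra_simps)
qed

text \<open>\<open>E\<close> stands for a branch of the power of \<open>x\<close> with exponent
  \<open>1 - c\<close>, the second exponent at 0. Only its differential equation is assumed, which
  covers every branch on every slit domain.\<close>

lemma hg_solution_twist_zero:
  assumes u: "hg_solution (a - c + 1) (b - c + 1) (2 - c) S u" and "open S" "0 \<notin> S"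
    and E: "\<And>x. x \<in> S \<Longrightarrow> (E has_field_derivative (1 - c) / x * E x) (at x)"
  shows "hg_solution a b c S (\<lambda>x. E x * u x)"
proof (rule hg_solutionI[OF \<open>open S\<close>])
  fix x assume x: "x \<in> S"
  then have nz: "x \<noteq> 0" using assms by auto
  note D = hg_solutionD[OF u \<open>open S\<close> x]
  show "((\<lambda>x. E x * u x) has_field_derivative E x * ((1 - c) / x * u x + deriv u x)) (at x)"
    using D(1) E[OF x] by (auto intro!: derivative_eq_intros simp: algebra_simps)
  show "((\<lambda>x. E x * ((1 - c) / x * u x + deriv u x)) has_field_derivative
      E x * (deriv (deriv u) x + 2 * (1 - c) / x * deriv u x - c * (1 - c) / x ^ 2 * u x)) (at x)"
    using D(1,2) E[OF x] nz
    by (auto intro!: derivative_eq_intros simp: field_simps power2_eq_square)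
  have "x * (1 - x) * (E x * (deriv (deriv u) x + 2 * (1 - c) / x * deriv u x - c * (1 - c) / x ^ 2 * u x)) +
      (c - (a + b + 1) * x) * (E x * ((1 - c) / x * u x + deriv u x)) - a * b * (E x * u x) =
    E x * (x * (1 - x) * deriv (deriv u) x + ((2 - c) - ((a - c + 1) + (b - c + 1) + 1) * x) * deriv u x
      - (a - c + 1) * (b - c + 1) * u x)"
    using nz by (simp add: divide_simps power2_eq_square) (simp add: algebra_simps)
  also have "\<dots> = 0" using D(3) by simp
  finally show "x * (1 - x) * (E x * (deriv (deriv u) x + 2 * (1 - c) / x * deriv u x - c * (1 - c) / x ^ 2 * u x)) +
      (c - (a + b + 1) * x) * (E x * ((1 - c) / x * u x + deriv u x)) - a * b * (E x * u x) = 0" .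
qed

text \<open>\<open>E\<close> stands for a branch of the power of \<open>x\<close> with exponent
  \<open>- a\<close>; with a Gauss series for \<open>u\<close> the product is Kummer's solution at
  infinity.\<close>

lemma hg_solution_twist_infinity:
  assumes u: "hg_solution a (a - c + 1) (a - b + 1) T u" and "open S" "open T" "0 \<notin> S"
    and ST: "\<And>x. x \<in> S \<Longrightarrow> inverse x \<in> T"
    and E: "\<And>x. x \<in> S \<Longrightarrow> (E has_field_derivative - a / x * E x) (at x)"
  shows "hg_solution a b c S (\<lambda>x. E x * u (inverse x))"
proof -
  define v where "v = deriv u"
  define w where "w = deriv v"
  show ?thesis
  proof (rule hg_solutionI[OF \<open>open S\<close>])
    fix x assume x: "x \<in> S"
    then have nz: "x \<noteq> 0" using assms by auto
    note D = hg_solutionD[OF u \<open>open T\<close> ST[OF x], folded v_def, folded w_def]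
    have i: "(inverse has_field_derivative - (inverse x ^ 2)) (at x)"
      using nz by (auto intro!: derivative_eq_intros simp: power2_eq_square)
    note d1 = DERIV_chain2[OF D(1) i] and d2 = DERIV_chain2[OF D(2) i]
    have e: "(E has_field_derivative - a * inverse x * E x) (at x)"
      using E[OF x] by (simp add: divide_inverse)
    show "((\<lambda>x. E x * u (inverse x)) has_field_derivative
        E x * (- a * inverse x * u (inverse x) - v (inverse x) * inverse x ^ 2)) (at x)"
      by (rule DERIV_cong[OF DERIV_mult[OF e d1]]) (simp add: algebra_simps)
    have "((\<lambda>x. - a * inverse x * u (inverse x) - v (inverse x) * inverse x ^ 2) has_field_derivative
        a * inverse x ^ 2 * u (inverse x) + (a + 2) * inverse x ^ 3 * v (inverse x)
        + w (inverse x) * inverse x ^ 4) (at x)"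
      by (rule DERIV_cong[OF DERIV_diff[OF DERIV_mult[OF DERIV_cmult[OF i] d1] DERIV_mult[OF d2 DERIV_power[OF i]]]])
        (simp add: algebra_simps eval_nat_numeral)
    from DERIV_mult[OF e this]
    show "((\<lambda>x. E x * (- a * inverse x * u (inverse x) - v (inverse x) * inverse x ^ 2)) has_field_derivative
        E x * (a * (a + 1) * inverse x ^ 2 * u (inverse x) + 2 * (a + 1) * inverse x ^ 3 * v (inverse x)
          + w (inverse x) * inverse x ^ 4)) (at x)"
      by (rule DERIV_cong) (simp add: algebra_simps eval_nat_numeral)
    \<comment> \<open>All derivatives are written with \<open>inverse x\<close> instead of
      quotients, so the identity is polynomial modulo this single relation.\<close>
    have "x * inverse x = 1" using nz by simp
    then have "x * (1 - x) * (E x * (a * (a + 1) * inverse x ^ 2 * u (inverse x)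
          + 2 * (a + 1) * inverse x ^ 3 * v (inverse x) + w (inverse x) * inverse x ^ 4)) +
        (c - (a + b + 1) * x) * (E x * (- a * inverse x * u (inverse x) - v (inverse x) * inverse x ^ 2))
        - a * b * (E x * u (inverse x)) =
      - (E x * inverse x) * (inverse x * (1 - inverse x) * w (inverse x)
        + (a - b + 1 - (a + (a - c + 1) + 1) * inverse x) * v (inverse x)
        - a * (a - c + 1) * u (inverse x))"
      by algebra
    then show "x * (1 - x) * (E x * (a * (a + 1) * inverse x ^ 2 * u (inverse x)
          + 2 * (a + 1) * inverse x ^ 3 * v (inverse x) + w (inverse x) * inverse x ^ 4)) +
        (c - (a + b + 1) * x) * (E x * (- a * inverse x * u (inverse x) - v (inverse x) * inverse x ^ 2))
        - a * b * (E x * u (inverse x)) = 0"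
      using D(3) by simp
  qed
qed

section \<open>The Gauss series\<close>

text \<open>The quotient of consecutive coefficients tends to 1, whence convergence in the unit
  disc; the recursion \<open>rec\<close> is the differential equation compared coefficient by
  coefficient.\<close>

lemma hg_series_exists:
  fixes a b c :: complex
  assumes c: "\<And>n. c + of_nat n \<noteq> 0"
  obtains F where "hg_solution a b c (ball 0 1) F" and "F 0 = 1"
proof -
  define h where "h n = pochhammer a n * pochhammer b n / (pochhammer c n * fact n)" for n
  have rec: "of_nat (Suc n) * (c + of_nat n) * h (Suc n) = (a + of_nat n) * (b + of_nat n) * h n" for n
  proof -
    have "pochhammer c n \<noteq> 0" for n
      using c by (metis add.left_inverse pochhammer_eq_0_iff)
    then show ?thesis
      using c[of n] of_nat_neq_0[of n, where 'a = complex] unfolding h_def pochhammer_Suc fact_Suc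
      by (simp add: divide_simps del: of_nat_Suc)
  qed
  define G where "G = Abs_fps h"
  have G: "fps_nth G n = h n" for n by (simp add: G_def)
  have "summable (\<lambda>n. h n * of_real r ^ n)" if r: "0 < r" "ereal r < 1" for r
  proof -
    define q where "q n = (a + of_nat n) * (b + of_nat n) / (of_nat (Suc n) * (c + of_nat n))" for n
    have hS: "h (Suc n) = q n * h n" for n
      using c[of n] of_nat_neq_0[of n, where 'a = complex]
      unfolding q_def times_divide_eq_left rec[symmetric] by (simp del: of_nat_Suc)
    have lim: "(\<lambda>n. (z + of_nat n) / of_nat (Suc n)) \<longlonglongrightarrow> 1" for z :: complex
    proof -
      have "(\<lambda>n. (z - 1) * inverse (of_nat (Suc n)) + 1) \<longlonglongrightarrow> (z - 1) * 0 + 1"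
        by (intro tendsto_intros LIMSEQ_Suc[OF lim_inverse_n])
      moreover have "(z - 1) * inverse (of_nat (Suc n)) + 1 = (z + of_nat n) / of_nat (Suc n)" for n
        by (simp add: field_simps del: of_nat_Suc) simp
      ultimately show ?thesis by simp
    qed
    have "(\<lambda>n. ((a + of_nat n) / of_nat (Suc n)) * ((b + of_nat n) / of_nat (Suc n)) /
        ((c + of_nat n) / of_nat (Suc n))) \<longlonglongrightarrow> 1 * 1 / 1"
      by (intro tendsto_intros lim) simp
    moreover have "((a + of_nat n) / of_nat (Suc n)) * ((b + of_nat n) / of_nat (Suc n)) /
        ((c + of_nat n) / of_nat (Suc n)) = q n" for n
    proof -
      have "x / s * (y / s) / (z / s) = x * y / (s * z)" if "s \<noteq> 0" for x y z s :: complex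
        using that by (simp add: divide_simps)
      from this[OF of_nat_neq_0[of n]] show ?thesis unfolding q_def .
    qed
    ultimately have "(\<lambda>n. norm (q n)) \<longlonglongrightarrow> norm (1 :: complex)"
      by (intro tendsto_norm) simp
    then have "(\<lambda>n. norm (q n) * r) \<longlonglongrightarrow> 1 * r" by (intro tendsto_mult) auto
    moreover have "1 * r < (1 + r) / 2" using r by simp
    ultimately have "eventually (\<lambda>n. norm (q n) * r < (1 + r) / 2) sequentially"
      by (rule order_tendstoD(2))
    then obtain N where N: "\<And>n. n \<ge> N \<Longrightarrow> norm (q n) * r < (1 + r) / 2"
      by (auto simp: eventually_sequentially)
    show ?thesis
    proof (rule summable_ratio_test)
      show "(1 + r) / 2 < 1" using r by simp
      fix n assume "n \<ge> N"
      have "norm (h (Suc n) * of_real r ^ Suc n) = (norm (q n) * r) * norm (h n * of_real r ^ n)"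
        using r by (simp add: hS norm_mult norm_power)
      also have "\<dots> \<le> (1 + r) / 2 * norm (h n * of_real r ^ n)"
        using N[OF \<open>n \<ge> N\<close>] by (intro mult_right_mono) auto
      finally show "norm (h (Suc n) * of_real r ^ Suc n) \<le> (1 + r) / 2 * norm (h n * of_real r ^ n)" .
    qed
  qed
  then have "conv_radius h \<ge> 1" by (rule conv_radius_geI_ex')
  then have R: "fps_conv_radius G \<ge> 1" by (simp add: fps_conv_radius_def G)
  have R1: "fps_conv_radius (fps_deriv G) \<ge> 1" using R fps_conv_radius_deriv[of G] by (rule order_trans)
  have R2: "fps_conv_radius (fps_deriv (fps_deriv G)) \<ge> 1"
    using R1 fps_conv_radius_deriv[of "fps_deriv G"] by (rule order_trans)
  \<comment> \<open>The operator expanded into products with \<open>fps_X\<close>. Its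
    \<open>n\<close>-th coefficient is the difference of the two sides of \<open>rec\<close>;
    degrees 0 and 1 are treated apart because a product with two factors \<open>fps_X\<close> starts
    in degree 2.\<close>
  define L where "L = fps_X * fps_deriv (fps_deriv G) - fps_X * (fps_X * fps_deriv (fps_deriv G))
    + (fps_const c * fps_deriv G - fps_const (a + b + 1) * (fps_X * fps_deriv G)) - fps_const (a * b) * G"
  have L0: "L = 0"
  proof (rule fps_ext)
    fix n
    have "fps_nth L n = of_nat (Suc n) * (c + of_nat n) * h (Suc n) - (a + of_nat n) * (b + of_nat n) * h n"
    proof (cases n)
      case (Suc m)
      then show ?thesis by (cases m) (simp_all add: L_def G algebra_simps)
    qed (simp add: L_def G)
    then show "fps_nth L n = fps_nth 0 n" using rec[of n] by simp
  qed
  have "hg_solution a b c (ball 0 1) (eval_fps G)"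
  proof (rule hg_solutionI[OF open_ball])
    fix x :: complex assume "x \<in> ball 0 1"
    then have nx: "ereal (norm x) < 1" by simp
    have x: "ereal (norm x) < fps_conv_radius G" "ereal (norm x) < fps_conv_radius (fps_deriv G)"
      "ereal (norm x) < fps_conv_radius (fps_deriv (fps_deriv G))"
      using less_le_trans[OF nx R] less_le_trans[OF nx R1] less_le_trans[OF nx R2] .
    show "(eval_fps G has_field_derivative eval_fps (fps_deriv G) x) (at x)"
      using x by (intro has_field_derivative_eval_fps)
    show "(eval_fps (fps_deriv G) has_field_derivative eval_fps (fps_deriv (fps_deriv G)) x) (at x)"
      using x by (intro has_field_derivative_eval_fps)
    have mult: "ereal (norm x) < fps_conv_radius (f * g)" and diff: "ereal (norm x) < fps_conv_radius (f - g)"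
      and add: "ereal (norm x) < fps_conv_radius (f + g)"
      if "ereal (norm x) < fps_conv_radius f" "ereal (norm x) < fps_conv_radius g" for f g :: "complex fps"
    proof -
      have "ereal (norm x) < min (fps_conv_radius f) (fps_conv_radius g)" using that by simp
      note * = less_le_trans[OF this]
      show "ereal (norm x) < fps_conv_radius (f * g)" "ereal (norm x) < fps_conv_radius (f - g)"
        "ereal (norm x) < fps_conv_radius (f + g)"
        by (rule *, rule fps_conv_radius_mult fps_conv_radius_diff fps_conv_radius_add)+
    qed
    have "eval_fps L x = 0" by (simp add: L0)
    moreover have "eval_fps L x = x * eval_fps (fps_deriv (fps_deriv G)) x
        - x * (x * eval_fps (fps_deriv (fps_deriv G)) x) + (c * eval_fps (fps_deriv G) x
        - (a + b + 1) * (x * eval_fps (fps_deriv G) x)) - a * b * eval_fps G x"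
      unfolding L_def using x
      by (simp add: eval_fps_diff eval_fps_add eval_fps_mult mult diff add
          del: fps_const_mult fps_const_add)
    ultimately show "x * (1 - x) * eval_fps (fps_deriv (fps_deriv G)) x
        + (c - (a + b + 1) * x) * eval_fps (fps_deriv G) x - a * b * eval_fps G x = 0"
      by (simp add: algebra_simps)
  qed
  moreover have "eval_fps G 0 = 1" by (simp add: eval_fps_at_0 G h_def)
  ultimately show ?thesis by (rule that)
qed

section \<open>The hypergeometric equation on slit planes\<close>

text \<open>Both half-planes, joined through the part \<open>I\<close> of the real axis.\<close>

definition slit :: "real set \<Rightarrow> complex set" where
  "slit I = {z. Im z = 0 \<longrightarrow> Re z \<in> I}"

lemma open_slit: "open I \<Longrightarrow> open (slit I)"
proof -
  assume "open I"
  then have "open ((Im -` (- {0})) \<union> Re -` I)"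
    by (intro open_Un open_vimage continuous_intros) auto
  moreover have "slit I = (Im -` (- {0})) \<union> Re -` I" by (auto simp: slit_def)
  ultimately show ?thesis by simp
qed

text \<open>For non-real \<open>z\<close> the point \<open>p\<close> is the only real point of the
  segment; for real \<open>z\<close> convexity of \<open>I\<close> applies.\<close>

lemma slit_segment:
  assumes "convex I" "p \<in> I" "z \<in> slit I"
  shows "closed_segment (of_real p) z \<subseteq> slit I"
proof
  fix w assume "w \<in> closed_segment (of_real p) z"
  then obtain t where t: "0 \<le> t" "t \<le> 1" "w = (1 - t) *\<^sub>R of_real p + t *\<^sub>R z"
    by (auto simp: closed_segment_def)
  have "(1 - t) * p + t * Re z \<in> I" if "Re z \<in> I"
    using convexD_alt[OF assms(1,2) that t(1,2)] by simp
  then show "w \<in> slit I" using assms(2,3) t by (auto simp: slit_def)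
qed

lemma connected_slit:
  assumes "convex I" "p \<in> I"
  shows "connected (slit I)"
proof (rule starlike_imp_connected)
  have "of_real p \<in> slit I" using assms by (simp add: slit_def)
  then show "starlike (slit I)" using slit_segment[OF assms] unfolding starlike_def by blast
qed

lemma of_real_in_slit [simp]: "of_real p \<in> slit I \<longleftrightarrow> p \<in> I"
  by (simp add: slit_def)

lemma zero_one_in_slit [simp]: "0 \<in> slit I \<longleftrightarrow> 0 \<in> I" "1 \<in> slit I \<longleftrightarrow> 1 \<in> I"
  by (simp_all add: slit_def)

lemma slit_Im [simp]: "Im z \<noteq> 0 \<Longrightarrow> z \<in> slit I" by (simp add: slit_def)

lemma slit_nonempty [simp]: "slit I \<noteq> {}"
  using slit_Im[of \<i> I] by (metis empty_iff imaginary_unit.sel(2) zero_neq_one)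

lemma open_connected_slits [simp, intro]:
  "open (slit {0<..<1})" "connected (slit {0<..<1})" "open (slit {..<0})" "connected (slit {..<0})"
  "open (slit {1<..})" "connected (slit {1<..})"
  using connected_slit[of "{0<..<1}" "1/2"] connected_slit[of "{..<0}" "-1"] connected_slit[of "{1<..}" "2"]
  by (auto intro: open_slit)

lemma halfplanes [simp, intro]:
  "open {z. 0 < Im z}" "connected {z. 0 < Im z}" "{z. 0 < Im z} \<noteq> {}" "{z. 0 < Im z} \<subseteq> slit I"
  "open {z. Im z < 0}" "connected {z. Im z < 0}" "{z. Im z < 0} \<noteq> {}" "{z. Im z < 0} \<subseteq> slit I"
  using open_halfspace_Im_gt[of 0] open_halfspace_Im_lt[of 0]
    convex_connected[OF convex_halfspace_Im_gt[of 0]] convex_connected[OF convex_halfspace_Im_lt[of 0]]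
  by (auto simp: slit_def intro: exI[of _ \<i>] exI[of _ "- \<i>"])

lemma ex_Im_sign [simp]: "\<exists>z. 0 < Im z" "\<exists>z. Im z < 0"
proof -
  show "\<exists>z. 0 < Im z" by (rule exI[of _ \<i>]) simp
  show "\<exists>z. Im z < 0" by (rule exI[of _ "- \<i>"]) simp
qed

section \<open>Local solutions at 0, 1 and infinity and their jumps\<close>

text \<open>The initial value problem at the real point \<open>p\<close> with the data of
  \<open>F\<close> has a solution on the whole slit plane. The part of the unit disc in the slit
  plane is again starlike about \<open>p\<close>, so uniqueness identifies the solution with
  \<open>F\<close> there.\<close>

lemma hg_solution_extend_slit:
  assumes F: "hg_solution a b c (ball 0 1) F" and I: "open I" "convex I" "p \<in> I" "0 \<notin> I" "1 \<notin> I"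
    and "\<bar>p\<bar> < 1"
  obtains f where "hg_solution a b c (slit I) f" "\<And>x. x \<in> slit I \<Longrightarrow> norm x < 1 \<Longrightarrow> f x = F x"
proof -
  define q where "q = complex_of_real p"
  obtain f where f: "hg_solution a b c (slit I) f" "f q = F q" "deriv f q = deriv F q"
    unfolding q_def
    by (rule hg_solution_exists[OF open_slit[OF I(1)] _ slit_segment[OF I(2,3)]]) (use I in auto)
  define D where "D = slit I \<inter> ball 0 1"
  have q: "q \<in> D" using I \<open>\<bar>p\<bar> < 1\<close> by (simp add: D_def q_def)
  have D: "open D" "0 \<notin> D" "1 \<notin> D" "D \<subseteq> slit I" "D \<subseteq> ball 0 1"
    using I by (auto simp: D_def intro: open_slit)
  have "closed_segment q x \<subseteq> D" if "x \<in> D" for x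
    using that slit_segment[OF I(2,3), of x] closed_segment_subset[OF _ _ convex_ball, of q 0 1 x] q
    by (auto simp: D_def q_def)
  then have conn: "connected D"
    using q by (intro starlike_imp_connected) (auto simp: starlike_def)
  have sol: "hg_solution a b c D (\<lambda>x. 1 * f x + (- 1) * F x)"
    using f(1) F D by (intro hg_solution_lincomb) (auto intro: hg_solution_subset)
  have "((\<lambda>x. 1 * f x + (- 1) * F x) has_field_derivative 1 * deriv f q + (- 1) * deriv F q) (at q)"
    using hg_solutionD(1)[OF f(1) open_slit[OF I(1)], of q] hg_solutionD(1)[OF F open_ball, of q] q
    by (auto simp: D_def intro!: derivative_eq_intros)
  then have d: "deriv (\<lambda>x. 1 * f x + (- 1) * F x) q = 0" using f by (auto dest: DERIV_imp_deriv)
  have "1 * f x + (- 1) * F x = 0" if "x \<in> D" for x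
    by (rule hg_solution_eq_0[OF sol D(1) conn q D(2,3) _ d that]) (use f in auto)
  then show ?thesis using that[OF f(1)] by (auto simp: D_def)
qed

text \<open>\<open>f\<close> and \<open>g\<close> extend the same power series through the two sides
  of 0, so the solution with exponent 0 is unchanged by a circuit around 0. It is not identically
  zero because the series is 1 at 0.\<close>

lemma hg_regular_zero:
  assumes c: "\<And>n. c + of_nat n \<noteq> 0"
  obtains f g where "hg_solution a b c (slit {0<..<1}) f" and "hg_solution a b c (slit {..<0}) g"
    and "\<And>x. Im x \<noteq> 0 \<Longrightarrow> f x = g x" and "\<exists>x. 0 < Im x \<and> f x \<noteq> 0"
proof -
  obtain F where F: "hg_solution a b c (ball 0 1) F" "F 0 = 1"
    using hg_series_exists[OF c] by blast
  obtain f where f: "hg_solution a b c (slit {0<..<1}) f"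
    "\<And>x. x \<in> slit {0<..<1} \<Longrightarrow> norm x < 1 \<Longrightarrow> f x = F x"
    by (rule hg_solution_extend_slit[OF F(1), of "{0<..<1}" "1/2"]) auto
  obtain g where g: "hg_solution a b c (slit {..<0}) g"
    "\<And>x. x \<in> slit {..<0} \<Longrightarrow> norm x < 1 \<Longrightarrow> g x = F x"
    by (rule hg_solution_extend_slit[OF F(1), of "{..<0}" "- 1/2"]) auto
  have "\<i> / 2 \<in> {z. 0 < Im z} \<inter> ball 0 1" "- \<i> / 2 \<in> {z. Im z < 0} \<inter> ball 0 1"
    by (auto simp: norm_divide)
  then have ne: "{z. 0 < Im z} \<inter> ball 0 1 \<noteq> {}" "{z. Im z < 0} \<inter> ball 0 1 \<noteq> {}"
    by blast+
  have "f x = g x" if x: "Im x \<noteq> 0" for x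
  proof (cases "0 < Im x")
    case True
    show ?thesis
      by (rule hg_solution_eq_open[OF hg_solution_subset[OF f(1)] hg_solution_subset[OF g(1)],
            of "{z. 0 < Im z}" "{z. 0 < Im z} \<inter> ball 0 1"]) (use True ne f g in auto)
  next
    case False
    show ?thesis
      by (rule hg_solution_eq_open[OF hg_solution_subset[OF f(1)] hg_solution_subset[OF g(1)],
            of "{z. Im z < 0}" "{z. Im z < 0} \<inter> ball 0 1"]) (use False x ne f g in auto)
  qed
  moreover have "\<exists>x. 0 < Im x \<and> f x \<noteq> 0"
  proof (rule ccontr)
    assume "\<not> ?thesis"
    then have Z: "F x = 0" if "x \<in> {z. 0 < Im z} \<inter> ball 0 1" for x
      using that f(2)[of x] by auto
    have "F 0 = 0"
      by (rule analytic_continuation_open[of "{z. 0 < Im z} \<inter> ball 0 1" "ball 0 1" F "\<lambda>_. 0"])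
        (use ne F(1) Z in \<open>auto simp: hg_solution_def\<close>)
    then show False using F(2) by simp
  qed
  ultimately show ?thesis using that f(1) g(1) by blast
qed

text \<open>
  The function \<open>Ln (- x) + \<i> * pi\<close> is the branch of the logarithm on \<open>slit {..<0}\<close> that agrees with
  \<^const>\<open>Ln\<close> on the upper half-plane.
\<close>

lemma Ln_minus_ii:
  assumes "Im x \<noteq> 0"
  shows "Ln (- x) + \<i> * of_real pi = (if 0 < Im x then Ln x else Ln x + 2 * of_real pi * \<i>)"
proof -
  have "x \<noteq> 0" using assms by auto
  then show ?thesis using assms Ln_minus[of x] by (auto simp: algebra_simps)
qed

lemma power_branch_derivative:
  shows "x \<in> slit {0<..} \<Longrightarrow> ((\<lambda>x. exp (k * Ln x)) has_field_derivative k / x * exp (k * Ln x)) (at x)"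
    and "x \<in> slit {..<0} \<Longrightarrow> ((\<lambda>x. exp (k * (Ln (- x) + \<i> * of_real pi))) has_field_derivative
      k / x * exp (k * (Ln (- x) + \<i> * of_real pi))) (at x)"
proof -
  assume x: "x \<in> slit {0<..}"
  then have "x \<notin> \<real>\<^sub>\<le>\<^sub>0" by (auto simp: slit_def complex_nonpos_Reals_iff)
  then show "((\<lambda>x. exp (k * Ln x)) has_field_derivative k / x * exp (k * Ln x)) (at x)"
    by (auto intro!: derivative_eq_intros simp: divide_inverse)
next
  assume x: "x \<in> slit {..<0}"
  then have "- x \<notin> \<real>\<^sub>\<le>\<^sub>0" by (auto simp: slit_def complex_nonpos_Reals_iff)
  then show "((\<lambda>x. exp (k * (Ln (- x) + \<i> * of_real pi))) has_field_derivative
      k / x * exp (k * (Ln (- x) + \<i> * of_real pi))) (at x)"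
    by (auto intro!: derivative_eq_intros simp: divide_inverse)
qed

text \<open>The series for the exponents 0 and \<open>1 - c\<close> exist since neither
  \<open>c\<close> nor \<open>2 - c\<close> is an integer. \<open>f2\<close> is built with the
  principal logarithm, \<open>g2\<close> with the branch continued across the negative axis, which
  exceeds it by 2 pi i below the axis; the factor is therefore exp (2 pi i (1 - c)).\<close>

lemma hg_local_zero:
  assumes c: "c \<notin> \<int>"
  obtains f1 f2 g1 g2 where
    "hg_solution a b c (slit {0<..<1}) f1" "hg_solution a b c (slit {0<..<1}) f2"
    "hg_solution a b c (slit {..<0}) g1" "hg_solution a b c (slit {..<0}) g2"
    "\<exists>x. 0 < Im x \<and> f1 x \<noteq> 0" "\<exists>x. 0 < Im x \<and> f2 x \<noteq> 0"
    "\<And>x. Im x \<noteq> 0 \<Longrightarrow> g1 x = f1 x" "\<And>x. 0 < Im x \<Longrightarrow> g2 x = f2 x"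
    "\<And>x. Im x < 0 \<Longrightarrow> g2 x = exp (- (2 * of_real pi * \<i> * c)) * f2 x"
proof -
  have "c + of_nat n \<noteq> 0" for n using c by (metis Ints_minus Ints_of_nat add_eq_0_iff2)
  then obtain f1 g1 where 1: "hg_solution a b c (slit {0<..<1}) f1" "hg_solution a b c (slit {..<0}) g1"
    "\<And>x. Im x \<noteq> 0 \<Longrightarrow> f1 x = g1 x" "\<exists>x. 0 < Im x \<and> f1 x \<noteq> 0"
    by (rule hg_regular_zero) (rule that; assumption)
  have "2 - c + of_nat n \<noteq> 0" for n
  proof
    assume "2 - c + of_nat n = 0"
    then have "c = of_nat (n + 2)" by (simp add: algebra_simps)
    then show False using c by simp
  qed
  then obtain u v where 2: "hg_solution (a - c + 1) (b - c + 1) (2 - c) (slit {0<..<1}) u"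
    "hg_solution (a - c + 1) (b - c + 1) (2 - c) (slit {..<0}) v"
    "\<And>x. Im x \<noteq> 0 \<Longrightarrow> u x = v x" "\<exists>x. 0 < Im x \<and> u x \<noteq> 0"
    by (rule hg_regular_zero) (rule that; assumption)
  define f2 where "f2 x = exp ((1 - c) * Ln x) * u x" for x
  define g2 where "g2 x = exp ((1 - c) * (Ln (- x) + \<i> * of_real pi)) * v x" for x
  have "hg_solution a b c (slit {0<..<1}) f2" unfolding f2_def
  proof (rule hg_solution_twist_zero[OF 2(1)])
    fix x assume "x \<in> slit {0<..<1}"
    then have "x \<in> slit {0<..}" by (auto simp: slit_def)
    then show "((\<lambda>x. exp ((1 - c) * Ln x)) has_field_derivative (1 - c) / x * exp ((1 - c) * Ln x)) (at x)"
      by (rule power_branch_derivative)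
  qed auto
  moreover have "hg_solution a b c (slit {..<0}) g2" unfolding g2_def
    by (rule hg_solution_twist_zero[OF 2(2) _ _ power_branch_derivative(2)]) auto
  moreover have "\<exists>x. 0 < Im x \<and> f2 x \<noteq> 0" using 2(4) by (auto simp: f2_def)
  moreover have "g2 x = f2 x" if "0 < Im x" for x
    using that 2(3)[of x] Ln_minus_ii[of x] by (simp add: f2_def g2_def)
  moreover have "g2 x = exp (- (2 * of_real pi * \<i> * c)) * f2 x" if "Im x < 0" for x
  proof -
    have "exp ((1 - c) * (Ln x + 2 * of_real pi * \<i>)) =
        exp ((1 - c) * Ln x) * exp (2 * of_real pi * \<i>) * exp (- (2 * of_real pi * \<i> * c))"
      by (simp only: exp_add[symmetric]) (simp add: algebra_simps)
    then show ?thesis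
      using that 2(3)[of x] by (simp add: f2_def g2_def Ln_minus_ii)
  qed
  ultimately show ?thesis using 1 by (intro that[of f1 f2 g1 g2]) simp_all
qed

text \<open>Obtained from the solutions at 0 by reflection, which interchanges the half-planes: the
  branches now agree below the real axis and differ above it.\<close>

lemma hg_local_one:
  assumes c: "a + b - c \<notin> \<int>"
  obtains f1 f2 g1 g2 where
    "hg_solution a b c (slit {0<..<1}) f1" "hg_solution a b c (slit {0<..<1}) f2"
    "hg_solution a b c (slit {1<..}) g1" "hg_solution a b c (slit {1<..}) g2"
    "\<exists>x. Im x < 0 \<and> f1 x \<noteq> 0" "\<exists>x. Im x < 0 \<and> f2 x \<noteq> 0"
    "\<And>x. Im x \<noteq> 0 \<Longrightarrow> g1 x = f1 x" "\<And>x. Im x < 0 \<Longrightarrow> g2 x = f2 x"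
    "\<And>x. 0 < Im x \<Longrightarrow> g2 x = exp (2 * of_real pi * \<i> * (c - a - b)) * f2 x"
proof -
  define d where "d = a + b + 1 - c"
  have "d \<notin> \<int>"
    using c Ints_diff[of d 1] by (auto simp: d_def algebra_simps)
  then obtain f1 f2 g1 g2 where *:
    "hg_solution a b d (slit {0<..<1}) f1" "hg_solution a b d (slit {0<..<1}) f2"
    "hg_solution a b d (slit {..<0}) g1" "hg_solution a b d (slit {..<0}) g2"
    "\<exists>x. 0 < Im x \<and> f1 x \<noteq> 0" "\<exists>x. 0 < Im x \<and> f2 x \<noteq> 0"
    "\<And>x. Im x \<noteq> 0 \<Longrightarrow> g1 x = f1 x" "\<And>x. 0 < Im x \<Longrightarrow> g2 x = f2 x"
    "\<And>x. Im x < 0 \<Longrightarrow> g2 x = exp (- (2 * of_real pi * \<i> * d)) * f2 x"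
    by (rule hg_local_zero) (rule that; assumption)
  have e: "exp (- (2 * of_real pi * \<i> * d)) = exp (2 * of_real pi * \<i> * (c - a - b))"
  proof -
    have "exp (2 * of_real pi * \<i> * (c - a - b)) = exp (- (2 * of_real pi * \<i> * d)) * exp (2 * of_real pi * \<i>)"
      by (simp only: exp_add[symmetric]) (simp add: d_def algebra_simps)
    then show ?thesis by simp
  qed
  have nz: "\<exists>x. Im x < 0 \<and> f (1 - x) \<noteq> 0" if ex: "\<exists>x. 0 < Im x \<and> f x \<noteq> 0" for f :: "complex \<Rightarrow> complex"
  proof -
    obtain x where "0 < Im x" "f x \<noteq> 0" using ex by blast
    then show ?thesis by (intro exI[of _ "1 - x"]) simp
  qed
  show ?thesis
  proof (rule that)
    show "hg_solution a b c (slit {0<..<1}) (\<lambda>x. f1 (1 - x))"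
      by (rule hg_solution_reflect[OF *(1)[unfolded d_def]]) (simp, simp, simp add: slit_def)
    show "hg_solution a b c (slit {0<..<1}) (\<lambda>x. f2 (1 - x))"
      by (rule hg_solution_reflect[OF *(2)[unfolded d_def]]) (simp, simp, simp add: slit_def)
    show "hg_solution a b c (slit {1<..}) (\<lambda>x. g1 (1 - x))"
      by (rule hg_solution_reflect[OF *(3)[unfolded d_def]]) (simp, simp, simp add: slit_def)
    show "hg_solution a b c (slit {1<..}) (\<lambda>x. g2 (1 - x))"
      by (rule hg_solution_reflect[OF *(4)[unfolded d_def]]) (simp, simp, simp add: slit_def)
  qed (use *(5-9) nz e in auto)
qed

text \<open>Inversion maps the ray beyond 1 to the interval from 0 to 1 and the negative axis to
  itself. The series in \<open>inverse x\<close> is therefore the same off the real axis on both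
  slit domains, and only the two branches of the power differ. Treating one exponent at a time keeps
  the assumption on \<open>a - b\<close> one-sided.\<close>

lemma hg_local_infinity:
  assumes c: "\<And>n. a - b + 1 + of_nat n \<noteq> 0"
  obtains g h where "hg_solution a b c (slit {..<0}) g" "hg_solution a b c (slit {1<..}) h"
    "\<exists>x. Im x < 0 \<and> g x \<noteq> 0" "\<And>x. 0 < Im x \<Longrightarrow> h x = g x"
    "\<And>x. Im x < 0 \<Longrightarrow> h x = exp (2 * of_real pi * \<i> * a) * g x"
proof -
  obtain u v where 2: "hg_solution a (a - c + 1) (a - b + 1) (slit {0<..<1}) u"
    "hg_solution a (a - c + 1) (a - b + 1) (slit {..<0}) v"
    "\<And>x. Im x \<noteq> 0 \<Longrightarrow> u x = v x" "\<exists>x. 0 < Im x \<and> u x \<noteq> 0"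
    by (rule hg_regular_zero[OF c]) (rule that; assumption)
  define h where "h x = exp (- a * Ln x) * u (inverse x)" for x
  define g where "g x = exp (- a * (Ln (- x) + \<i> * of_real pi)) * v (inverse x)" for x
  have im: "Im (inverse x) = 0 \<longleftrightarrow> Im x = 0" "0 < Im (inverse x) \<longleftrightarrow> Im x < 0" for x
  proof -
    have "x = 0 \<or> 0 < (Re x)\<^sup>2 + (Im x)\<^sup>2"
      by (metis complex_eq_iff sum_power2_gt_zero_iff zero_complex.simps)
    then show "Im (inverse x) = 0 \<longleftrightarrow> Im x = 0" "0 < Im (inverse x) \<longleftrightarrow> Im x < 0"
      by (auto simp: zero_less_divide_iff divide_less_0_iff)
  qed
  have re: "Re (inverse x) = inverse (Re x)" if "Im x = 0" for x
    using that by (cases "Re x = 0") (simp_all add: power2_eq_square divide_inverse)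
  have inv: "inverse x \<in> slit {0<..<1}" if "x \<in> slit {1<..}" for x
    unfolding slit_def using that im(1)[of x] re[of x] one_less_inverse_iff[of "inverse (Re x)"]
    by (auto simp: slit_def simp del: inverse_complex.simps)
  have inv': "inverse x \<in> slit {..<0}" if "x \<in> slit {..<0}" for x
    unfolding slit_def using that im(1)[of x] re[of x]
    by (auto simp: slit_def simp del: inverse_complex.simps)
  have "hg_solution a b c (slit {1<..}) h" unfolding h_def
  proof (rule hg_solution_twist_infinity[OF 2(1) _ _ _ inv])
    fix x assume "x \<in> slit {1<..}"
    then have "x \<in> slit {0<..}" by (auto simp: slit_def)
    then show "((\<lambda>x. exp (- a * Ln x)) has_field_derivative - a / x * exp (- a * Ln x)) (at x)"
      by (rule power_branch_derivative)
  qed auto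
  moreover have "hg_solution a b c (slit {..<0}) g" unfolding g_def
    by (rule hg_solution_twist_infinity[OF 2(2) _ _ _ inv' power_branch_derivative(2)]) auto
  moreover have "\<exists>x. Im x < 0 \<and> g x \<noteq> 0"
  proof -
    obtain y where y: "0 < Im y" "u y \<noteq> 0" using 2(4) by blast
    then have "Im (inverse y) < 0" using im(2)[of "inverse y"] by simp
    then show ?thesis using y 2(3)[of y] by (intro exI[of _ "inverse y"]) (auto simp: g_def)
  qed
  moreover have "h x = g x" if "0 < Im x" for x
    using that 2(3)[of "inverse x"] im(1)[of x] Ln_minus_ii[of x] by (simp add: h_def g_def)
  moreover have "h x = exp (2 * of_real pi * \<i> * a) * g x" if "Im x < 0" for x
  proof -
    have "exp (2 * of_real pi * \<i> * a) * exp (- a * (Ln x + 2 * of_real pi * \<i>)) = exp (- a * Ln x)"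
      by (simp only: exp_add[symmetric]) (simp add: algebra_simps)
    then show ?thesis
      using that 2(3)[of "inverse x"] im(1)[of x] by (simp add: h_def g_def Ln_minus_ii)
  qed
  ultimately show ?thesis by (intro that[of g h]) simp_all
qed

section \<open>Continuation between half-planes\<close>

abbreviation UH :: "complex set" where "UH \<equiv> {z. 0 < Im z}"
abbreviation LH :: "complex set" where "LH \<equiv> {z. Im z < 0}"

text \<open>
  Crossing from the half-plane \<open>U\<close> to the half-plane \<open>V\<close> through the interval \<open>I\<close> turns \<open>f\<close> into \<open>k\<close>.
  For solutions \<open>f\<close>, \<open>k\<close> on \<open>slit {0<..<1}\<close> this is continuation around 0 if \<open>I\<close> is \<open>{..<0}\<close>, and
  around 1 if \<open>I\<close> is \<open>{1<..}\<close>.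
\<close>

definition continues ::
  "complex \<Rightarrow> complex \<Rightarrow> complex \<Rightarrow> real set \<Rightarrow> complex set \<Rightarrow> complex set \<Rightarrow>
    (complex \<Rightarrow> complex) \<Rightarrow> (complex \<Rightarrow> complex) \<Rightarrow> bool" where
  "continues a b c I U V f k \<longleftrightarrow>
     (\<exists>F. hg_solution a b c (slit I) F \<and> (\<forall>x\<in>U. F x = f x) \<and> (\<forall>x\<in>V. F x = k x))"

lemma continues_lincomb:
  assumes "continues a b c I U V f k" "continues a b c I U V f' k'" "open I"
  shows "continues a b c I U V (\<lambda>x. s * f x + t * f' x) (\<lambda>x. s * k x + t * k' x)"
proof -
  obtain F F' where F: "hg_solution a b c (slit I) F" "\<forall>x\<in>U. F x = f x" "\<forall>x\<in>V. F x = k x"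
    "hg_solution a b c (slit I) F'" "\<forall>x\<in>U. F' x = f' x" "\<forall>x\<in>V. F' x = k' x"
    using assms by (auto simp: continues_def)
  then show ?thesis unfolding continues_def
    using hg_solution_lincomb[OF F(1,4) open_slit[OF \<open>open I\<close>]]
    by (intro exI[of _ "\<lambda>x. s * F x + t * F' x"]) auto
qed

lemma continues_cong:
  assumes "continues a b c I U V f k" "\<And>x. x \<in> U \<Longrightarrow> f' x = f x" "\<And>x. x \<in> V \<Longrightarrow> k' x = k x"
  shows "continues a b c I U V f' k'"
  using assms by (auto simp: continues_def)

lemma continues_unique:
  assumes "continues a b c I U V f k" "continues a b c I U V f k'"
    and "open (slit I)" "connected (slit I)" "open U" "U \<noteq> {}" "U \<subseteq> slit I" "V \<subseteq> slit I" "x \<in> V"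
  shows "k x = k' x"
proof -
  obtain F F' where F: "hg_solution a b c (slit I) F" "\<forall>x\<in>U. F x = f x" "\<forall>x\<in>V. F x = k x"
    "hg_solution a b c (slit I) F'" "\<forall>x\<in>U. F' x = f x" "\<forall>x\<in>V. F' x = k' x"
    using assms by (auto simp: continues_def)
  have "F x = F' x"
    by (rule hg_solution_eq_open[OF F(1,4) assms(3-7)]) (use F assms(8,9) in auto)
  then show ?thesis using F assms by auto
qed

lemma independent_on_subset:
  assumes "hg_solution a b c S f" "hg_solution a b c S g" "independent_on S f g"
    and "open S" "connected S" "open U" "U \<noteq> {}" "U \<subseteq> S"
  shows "independent_on U f g"
  unfolding independent_on_def
proof (intro allI impI)
  fix k l assume Z: "\<forall>x\<in>U. k * f x + l * g x = 0"
  have zero: "hg_solution a b c S (\<lambda>_. 0)" using hg_solution_cmult[OF assms(1,4), of 0] by simp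
  have "k * f x + l * g x = 0" if "x \<in> S" for x
    by (rule hg_solution_eq_open[OF hg_solution_lincomb[OF assms(1,2,4)] zero assms(4-8) _ that])
      (use Z in auto)
  then show "k = 0 \<and> l = 0" using assms(3) unfolding independent_on_def by blast
qed

lemma independent_onD:
  assumes "independent_on S f g" "\<And>x. x \<in> S \<Longrightarrow> k * f x + l * g x = k' * f x + l' * g x"
  shows "k = k' \<and> l = l'"
proof -
  have "(k - k') * f x + (l - l') * g x = 0" if "x \<in> S" for x
    using assms(2)[OF that] by (simp add: algebra_simps)
  then have "k - k' = 0 \<and> l - l' = 0" using assms(1) unfolding independent_on_def by blast
  then show ?thesis by simp
qed

text \<open>Eigenfunctions of a crossing for the eigenvalues 1 and \<mu> are independent: continuing
  a linear relation multiplies its second term by \<mu>, and subtraction isolates that term.\<close>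

lemma independent_on_eigenfunctions:
  assumes f: "hg_solution a b c S f1" "hg_solution a b c S f2"
    and "continues a b c I U V f1 f1" "continues a b c I U V f2 (\<lambda>x. \<mu> * f2 x)" "\<mu> \<noteq> 1"
    and nz: "\<exists>x\<in>U. f1 x \<noteq> 0" "\<exists>x\<in>U. f2 x \<noteq> 0"
    and S: "open S" "connected S" and I: "open I" "open (slit I)" "connected (slit I)"
    and U: "open U" "U \<noteq> {}" "U \<subseteq> slit I" "U \<subseteq> S" and V: "open V" "V \<noteq> {}" "V \<subseteq> slit I" "V \<subseteq> S"
  shows "independent_on S f1 f2"
  unfolding independent_on_def
proof (intro allI impI)
  fix k l assume Z: "\<forall>x\<in>S. k * f1 x + l * f2 x = 0"
  have zero: "hg_solution a b c S (\<lambda>_. 0)" using hg_solution_cmult[OF f(1) S(1), of 0] by simp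
  have "continues a b c I U V (\<lambda>x. k * f1 x + l * f2 x) (\<lambda>x. k * f1 x + l * (\<mu> * f2 x))"
    by (intro continues_lincomb assms)
  \<comment> \<open>The zero function, written as a combination with coefficients 0, continues to
    itself; by the relation \<open>Z\<close> it also represents \<open>k * f1 + l * f2\<close> on
    \<open>U\<close>.\<close>
  moreover have "continues a b c I U V (\<lambda>x. 0 * f1 x + 0 * f1 x) (\<lambda>x. 0 * f1 x + 0 * f1 x)"
    by (intro continues_lincomb assms)
  then have "continues a b c I U V (\<lambda>x. k * f1 x + l * f2 x) (\<lambda>x. 0)"
    using Z U by (auto elim!: continues_cong)
  ultimately have e: "k * f1 x + l * (\<mu> * f2 x) = 0" if "x \<in> V" for x
    by (rule continues_unique) (use I U V that in auto)
  have "(1 - \<mu>) * (l * f2 x) = 0" if "x \<in> V" for x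
  proof -
    have "k * f1 x + l * f2 x = 0" using Z V(4) that by blast
    then show ?thesis using e[OF that] by algebra
  qed
  then have "l * f2 x = 0" if "x \<in> V" for x using that \<open>\<mu> \<noteq> 1\<close> by simp
  then have "l * f2 x = 0" if "x \<in> S" for x
    by (rule hg_solution_eq_open[OF hg_solution_cmult[OF f(2) S(1)] zero S V(1,2,4) _ that])
  then have "l = 0" using nz U by fastforce
  moreover from this have "k = 0" using Z nz U by fastforce
  ultimately show "k = 0 \<and> l = 0" by simp
qed

section \<open>Eigenvalue equations for the circuit matrices and their solution\<close>

text \<open>Multiplication by the adjugate leaves multiples of the determinant. Row vectors occur
  because the coefficients of a solution multiply a circuit matrix from the left.\<close>

lemma row_eigenvector_det:
  fixes x y :: "'a::idom"
  assumes "x * p + y * r = 0" "x * q + y * s = 0" "\<not> (x = 0 \<and> y = 0)"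
  shows "p * s = q * r"
proof -
  have "x * (p * s - q * r) = 0" "y * (p * s - q * r) = 0" using assms(1,2) by algebra+
  then show ?thesis using assms(3) by auto
qed

lemma exp_two_pi_eq_1_iff: "exp (2 * of_real pi * \<i> * z) = 1 \<longleftrightarrow> z \<in> \<int>"
proof -
  have "exp (2 * of_real pi * \<i> * z) = 1 \<longleftrightarrow> (\<exists>n. z = of_int n)"
    unfolding exp_eq_1 by (auto simp: complex_eq_iff)
  then show ?thesis by (auto elim: Ints_cases)
qed

text \<open>Crossing the negative axis downwards and returning upwards beyond 1 multiplies the power
  solution by exp (- 2 pi i a). Its coefficients \<alpha>, \<beta> thus form a left eigenvector of
  the product of the two circuit matrices, and the conclusion is the vanishing of the characteristic
  determinant.\<close>

lemma hg_infinity_eigenvector: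
  assumes A: "\<And>n. a - b + 1 + of_nat n \<noteq> 0" and B: "B \<noteq> 0"
    and f: "hg_solution a b c (slit {0<..<1}) f1" "hg_solution a b c (slit {0<..<1}) f2"
    and ind: "independent_on (slit {0<..<1}) f1 f2"
    and z: "continues a b c {..<0} UH LH f1 f1" "continues a b c {..<0} UH LH f2 (\<lambda>x. inverse B * f2 x)"
    and o: "continues a b c {1<..} LH UH f1 (\<lambda>x. m11 * f1 x + m12 * f2 x)"
      "continues a b c {1<..} LH UH f2 (\<lambda>x. m21 * f1 x + m22 * f2 x)"
  shows "(m11 - exp (- (2 * of_real pi * \<i> * a))) * (m22 * inverse B - exp (- (2 * of_real pi * \<i> * a)))
    = m12 * (m21 * inverse B)"
proof -
  define E where "E = exp (2 * of_real pi * \<i> * a)"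
  have E: "exp (- (2 * of_real pi * \<i> * a)) = inverse E" "E \<noteq> 0" by (simp_all add: E_def exp_minus)
  obtain g h where g: "hg_solution a b c (slit {..<0}) g" and h: "hg_solution a b c (slit {1<..}) h"
    and nz: "\<exists>x. Im x < 0 \<and> g x \<noteq> 0" and gh: "\<And>x. 0 < Im x \<Longrightarrow> h x = g x"
    "\<And>x. Im x < 0 \<Longrightarrow> h x = E * g x"
    by (rule hg_local_infinity[OF A, of c, folded E_def]) (rule that; assumption)
  obtain \<alpha> \<beta> where ab: "\<And>x. x \<in> UH \<Longrightarrow> g x = \<alpha> * f1 x + \<beta> * f2 x"
    by (rule hg_solution_span[OF f ind, of UH g]) (auto intro: hg_solution_subset[OF g])
  have "continues a b c {..<0} UH LH (\<lambda>x. \<alpha> * f1 x + \<beta> * f2 x) (\<lambda>x. \<alpha> * f1 x + \<beta> * (inverse B * f2 x))"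
    by (intro continues_lincomb z) auto
  moreover have "continues a b c {..<0} UH LH (\<lambda>x. \<alpha> * f1 x + \<beta> * f2 x) g"
    using g ab by (auto simp: continues_def)
  ultimately have gL: "g x = \<alpha> * f1 x + \<beta> * (inverse B * f2 x)" if "x \<in> LH" for x
    by (rule continues_unique[symmetric]) (use that in auto)
  define \<beta>' where "\<beta>' = \<beta> * inverse B"
  have "continues a b c {1<..} LH UH (\<lambda>x. E * \<alpha> * f1 x + E * \<beta>' * f2 x)
      (\<lambda>x. E * \<alpha> * (m11 * f1 x + m12 * f2 x) + E * \<beta>' * (m21 * f1 x + m22 * f2 x))"
    by (intro continues_lincomb o) auto
  moreover have "continues a b c {1<..} LH UH (\<lambda>x. E * \<alpha> * f1 x + E * \<beta>' * f2 x) (\<lambda>x. \<alpha> * f1 x + \<beta> * f2 x)"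
    unfolding continues_def using h gh gL ab
    by (intro exI[of _ h]) (auto simp: \<beta>'_def algebra_simps)
  ultimately have "E * \<alpha> * (m11 * f1 x + m12 * f2 x) + E * \<beta>' * (m21 * f1 x + m22 * f2 x)
      = \<alpha> * f1 x + \<beta> * f2 x" if "x \<in> UH" for x
    by (rule continues_unique) (use that in auto)
  then have "E * (\<alpha> * m11 + \<beta>' * m21) = \<alpha> \<and> E * (\<alpha> * m12 + \<beta>' * m22) = \<beta>"
    by (intro independent_onD[OF independent_on_subset[OF f ind, of UH]]) (auto simp: algebra_simps)
  then have "\<alpha> * m11 + \<beta>' * m21 = inverse E * \<alpha>" "\<alpha> * m12 + \<beta>' * m22 = inverse E * \<beta>"
    using E(2) by (auto simp: field_simps)
  then have "\<alpha> * (m11 - inverse E) + \<beta> * (m21 * inverse B) = 0"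
    "\<alpha> * m12 + \<beta> * (m22 * inverse B - inverse E) = 0"
    by (simp_all add: \<beta>'_def algebra_simps)
  moreover have "\<not> (\<alpha> = 0 \<and> \<beta> = 0)" using nz gL by auto
  ultimately show ?thesis unfolding E by (rule row_eigenvector_det)
qed

text \<open>
  The disjunction covers the resonant case \<open>a - b \<in> \<int>\<close>, where the second solution at infinity may be
  logarithmic, but one of the two pure power solutions always exists.
\<close>

lemma hg_monodromy_equations:
  assumes "c \<notin> \<int>" "a + b - c \<notin> \<int>"
  obtains f1 f2 m11 m12 m21 m22 where
    "hg_solution a b c (slit {0<..<1}) f1" "hg_solution a b c (slit {0<..<1}) f2"
    "independent_on (slit {0<..<1}) f1 f2"
    "continues a b c {..<0} UH LH f1 f1"
    "continues a b c {..<0} UH LH f2 (\<lambda>x. exp (- (2 * of_real pi * \<i> * c)) * f2 x)"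
    "continues a b c {1<..} LH UH f1 (\<lambda>x. m11 * f1 x + m12 * f2 x)"
    "continues a b c {1<..} LH UH f2 (\<lambda>x. m21 * f1 x + m22 * f2 x)"
    "(m11 - 1) * (m22 - 1) = m12 * m21"
    "(m11 - exp (2 * of_real pi * \<i> * (c - a - b))) * (m22 - exp (2 * of_real pi * \<i> * (c - a - b))) = m12 * m21"
    "(m11 - exp (- (2 * of_real pi * \<i> * a))) * (m22 * exp (- (2 * of_real pi * \<i> * c)) - exp (- (2 * of_real pi * \<i> * a)))
      = m12 * (m21 * exp (- (2 * of_real pi * \<i> * c))) \<or>
     (m11 - exp (- (2 * of_real pi * \<i> * b))) * (m22 * exp (- (2 * of_real pi * \<i> * c)) - exp (- (2 * of_real pi * \<i> * b)))
      = m12 * (m21 * exp (- (2 * of_real pi * \<i> * c)))"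
proof -
  define B where "B = exp (2 * of_real pi * \<i> * c)"
  define L where "L = exp (2 * of_real pi * \<i> * (c - a - b))"
  have B: "exp (- (2 * of_real pi * \<i> * c)) = inverse B" "B \<noteq> 0" "inverse B \<noteq> 1"
    using exp_two_pi_eq_1_iff[of c] assms(1) by (simp_all add: B_def exp_minus)
  have "- (a + b - c) \<notin> \<int>" using assms(2) by (simp only: minus_in_Ints_iff not_False_eq_True)
  then have L: "L \<noteq> 1" using exp_two_pi_eq_1_iff[of "c - a - b"] by (simp add: L_def algebra_simps)
  obtain f1 f2 g1 g2 where
    f: "hg_solution a b c (slit {0<..<1}) f1" "hg_solution a b c (slit {0<..<1}) f2" and
    g: "hg_solution a b c (slit {..<0}) g1" "hg_solution a b c (slit {..<0}) g2" and
    nz: "\<exists>x. 0 < Im x \<and> f1 x \<noteq> 0" "\<exists>x. 0 < Im x \<and> f2 x \<noteq> 0" and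
    fg: "\<And>x. Im x \<noteq> 0 \<Longrightarrow> g1 x = f1 x" "\<And>x. 0 < Im x \<Longrightarrow> g2 x = f2 x"
    "\<And>x. Im x < 0 \<Longrightarrow> g2 x = exp (- (2 * of_real pi * \<i> * c)) * f2 x"
    using assms(1) by (rule hg_local_zero[of c a b]) (rule that; assumption)
  have z: "continues a b c {..<0} UH LH f1 f1" "continues a b c {..<0} UH LH f2 (\<lambda>x. inverse B * f2 x)"
    using f g fg unfolding continues_def B(1) by auto
  have ind: "independent_on (slit {0<..<1}) f1 f2"
    by (rule independent_on_eigenfunctions[OF f z B(3)]) (use nz in auto)
  obtain h1 h2 k1 k2 where
    h: "hg_solution a b c (slit {0<..<1}) h1" "hg_solution a b c (slit {0<..<1}) h2" and
    k: "hg_solution a b c (slit {1<..}) k1" "hg_solution a b c (slit {1<..}) k2" and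
    nzh: "\<exists>x. Im x < 0 \<and> h1 x \<noteq> 0" "\<exists>x. Im x < 0 \<and> h2 x \<noteq> 0" and
    hk: "\<And>x. Im x \<noteq> 0 \<Longrightarrow> k1 x = h1 x" "\<And>x. Im x < 0 \<Longrightarrow> k2 x = h2 x"
    "\<And>x. 0 < Im x \<Longrightarrow> k2 x = L * h2 x"
    using assms(2) by (rule hg_local_one[of a b c, folded L_def]) (rule that; assumption)
  have one: "continues a b c {1<..} LH UH h1 (\<lambda>x. 1 * h1 x)" "continues a b c {1<..} LH UH h2 (\<lambda>x. L * h2 x)"
    using h k hk unfolding continues_def by auto
  have indh: "independent_on (slit {0<..<1}) h1 h2"
    by (rule independent_on_eigenfunctions[OF h _ one(2) L]) (use nzh one in auto)
  \<comment> \<open>\<open>f1\<close> and \<open>f2\<close> are adapted to 0 and carry no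
    information beyond 1. They continue there because they are combinations of \<open>h1\<close> and
    \<open>h2\<close>, which do.\<close>
  have cont: "\<exists>r s. continues a b c {1<..} LH UH u (\<lambda>x. r * f1 x + s * f2 x)"
    if u: "hg_solution a b c (slit {0<..<1}) u" for u
  proof -
    obtain \<alpha> \<beta> where ab: "\<And>x. x \<in> slit {0<..<1} \<Longrightarrow> u x = \<alpha> * h1 x + \<beta> * h2 x"
      by (rule hg_solution_span[OF h indh, of "slit {0<..<1}" u]) (use u in auto)
    have "continues a b c {1<..} LH UH (\<lambda>x. \<alpha> * h1 x + \<beta> * h2 x) (\<lambda>x. \<alpha> * (1 * h1 x) + \<beta> * (L * h2 x))"
      by (intro continues_lincomb one) auto
    note cab = this
    have "hg_solution a b c (slit {0<..<1}) (\<lambda>x. \<alpha> * h1 x + \<beta> * L * h2 x)"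
      by (rule hg_solution_lincomb[OF h]) auto
    then obtain r s where rs: "\<And>x. x \<in> slit {0<..<1} \<Longrightarrow> \<alpha> * h1 x + \<beta> * L * h2 x = r * f1 x + s * f2 x"
      by (rule hg_solution_span[OF f ind, of "slit {0<..<1}", rotated 8]) auto
    have "continues a b c {1<..} LH UH u (\<lambda>x. r * f1 x + s * f2 x)"
      by (rule continues_cong[OF cab]) (use ab rs[symmetric] in \<open>auto simp: mult.assoc\<close>)
    then show ?thesis by (intro exI)
  qed
  obtain m11 m12 where m1: "continues a b c {1<..} LH UH f1 (\<lambda>x. m11 * f1 x + m12 * f2 x)"
    using cont[OF f(1)] by (elim exE)
  obtain m21 m22 where m2: "continues a b c {1<..} LH UH f2 (\<lambda>x. m21 * f1 x + m22 * f2 x)"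
    using cont[OF f(2)] by (elim exE)
  note m = m1 m2
  \<comment> \<open>Applied to \<open>h1\<close> and \<open>h2\<close>, this makes 1 and
    \<open>L\<close> roots of the characteristic polynomial of the matrix with entries
    \<open>m11\<close> to \<open>m22\<close>.\<close>
  have eig: "(m11 - \<mu>) * (m22 - \<mu>) = m12 * m21"
    if hu: "hg_solution a b c (slit {0<..<1}) u" and cu: "continues a b c {1<..} LH UH u (\<lambda>x. \<mu> * u x)"
      and nu: "\<exists>x. Im x < 0 \<and> u x \<noteq> 0" for u \<mu>
  proof -
    obtain \<alpha> \<beta> where ab: "\<And>x. x \<in> slit {0<..<1} \<Longrightarrow> u x = \<alpha> * f1 x + \<beta> * f2 x"
      by (rule hg_solution_span[OF f ind, of "slit {0<..<1}" u]) (use hu in auto)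
    have "continues a b c {1<..} LH UH (\<lambda>x. \<alpha> * f1 x + \<beta> * f2 x)
        (\<lambda>x. \<alpha> * (m11 * f1 x + m12 * f2 x) + \<beta> * (m21 * f1 x + m22 * f2 x))"
      by (intro continues_lincomb m) auto
    moreover have "continues a b c {1<..} LH UH (\<lambda>x. \<alpha> * f1 x + \<beta> * f2 x) (\<lambda>x. \<mu> * (\<alpha> * f1 x + \<beta> * f2 x))"
      by (rule continues_cong[OF cu]) (use ab in auto)
    ultimately have "\<alpha> * (m11 * f1 x + m12 * f2 x) + \<beta> * (m21 * f1 x + m22 * f2 x) =
        \<mu> * (\<alpha> * f1 x + \<beta> * f2 x)" if "x \<in> UH" for x
      by (rule continues_unique) (use that in auto)
    then have "\<alpha> * m11 + \<beta> * m21 = \<mu> * \<alpha> \<and> \<alpha> * m12 + \<beta> * m22 = \<mu> * \<beta>"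
      by (intro independent_onD[OF independent_on_subset[OF f ind, of UH]]) (auto simp: algebra_simps)
    then have "\<alpha> * (m11 - \<mu>) + \<beta> * m21 = 0" "\<alpha> * m12 + \<beta> * (m22 - \<mu>) = 0"
      by (simp_all add: algebra_simps)
    moreover have "\<not> (\<alpha> = 0 \<and> \<beta> = 0)" using nu ab by auto
    ultimately show ?thesis by (rule row_eigenvector_det)
  qed
  have inf: "(m11 - exp (- (2 * of_real pi * \<i> * a))) * (m22 * inverse B - exp (- (2 * of_real pi * \<i> * a)))
      = m12 * (m21 * inverse B) \<or>
     (m11 - exp (- (2 * of_real pi * \<i> * b))) * (m22 * inverse B - exp (- (2 * of_real pi * \<i> * b)))
      = m12 * (m21 * inverse B)"
  proof (cases "\<exists>n. a - b + 1 + of_nat n = 0")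
    case False
    then have "a - b + 1 + of_nat n \<noteq> 0" for n by blast
    then show ?thesis by (rule disjI1[OF hg_infinity_eigenvector[OF _ B(2) f ind z m]])
  next
    case True
    then obtain n where n: "a - b + 1 + of_nat n = 0" by blast
    \<comment> \<open>Otherwise \<open>a - b\<close> and \<open>b - a\<close> would both be negative
      integers.\<close>
    have "b - a + 1 + of_nat k \<noteq> 0" for k
    proof
      assume "b - a + 1 + of_nat k = 0"
      then have "(a - b + 1 + of_nat n) + (b - a + 1 + of_nat k) = 0" using n by simp
      moreover have "(a - b + 1 + of_nat n) + (b - a + 1 + of_nat k) = of_nat (n + k + 2)" by simp
      ultimately have "of_nat (n + k + 2) = (0 :: complex)" by simp
      then have "n + k + 2 = 0" by (simp only: of_nat_eq_0_iff)
      then show False by simp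
    qed
    note nz' = this
    have sw: "hg_solution b a c S u = hg_solution a b c S u" for S u by (rule hg_solution_commute)
    have "continues b a c I U V u v = continues a b c I U V u v" for I U V u v
      unfolding continues_def sw ..
    note hg_infinity_eigenvector[of b a B c, unfolded this sw, OF nz' B(2) f ind z m]
    then show ?thesis by (rule disjI2)
  qed
  note e1 = eig[OF h(1) one(1) nzh(1)] and e2 = eig[OF h(2) one(2) nzh(2)]
  show ?thesis
    by (rule that[of f1 f2 m11 m12 m21 m22, folded L_def, unfolded B(1)])
      (fact f(1) f(2) ind z(1) z(2) m1 m2 e1 e2 inf)+
qed

lemma monodromy_entries:
  fixes A A' B lam h p m11 m12 m21 m22 :: complex
  assumes nz: "A \<noteq> 0" "A' \<noteq> 0" "B \<noteq> 0" and ne: "A \<noteq> 1" "A' \<noteq> 1" "B \<noteq> 1" "A \<noteq> B" "A' \<noteq> B" "lam \<noteq> 1"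
    and lam: "lam = B / (A * A')"
    and h: "h = - (((A - B) * (A' - B)) / (B * (A - 1) * (A' - 1)))"
    and p: "p = (1 - lam) / (1 + h)"
    and 1: "(m11 - 1) * (m22 - 1) = m12 * m21"
    and 2: "(m11 - lam) * (m22 - lam) = m12 * m21"
    and 3: "(m11 - inverse A) * (m22 * inverse B - inverse A) = m12 * (m21 * inverse B)"
  shows "m11 = 1 - p" "m22 = 1 - h * p" "m12 * m21 = h * p * p" "p \<noteq> 0" "h \<noteq> 0" "1 + h \<noteq> 0"
proof -
  \<comment> \<open>The characteristic polynomial has the distinct roots 1 and \<open>lam\<close>;
    they yield trace and determinant.\<close>
  have "(lam - 1) * (m11 + m22 - 1 - lam) = 0" using 1 2 by algebra
  then have "m11 + m22 - 1 - lam = 0" using ne by simp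
  then have tr: "m11 + m22 = 1 + lam" by algebra
  have det: "m11 * m22 - m12 * m21 = lam" using 1 tr by algebra
  \<comment> \<open>The product of the two circuit matrices has determinant
    \<open>lam * inverse B\<close>, which is \<open>inverse A * inverse A'\<close>; one eigenvalue
    is \<open>inverse A\<close>, so the other is \<open>inverse A'\<close>.\<close>
  have "m11 + m22 * inverse B = inverse A + inverse A'"
  proof -
    have i: "A * inverse A = 1" "A' * inverse A' = 1" "B * inverse B = 1" using nz by auto
    have l: "lam * inverse B = inverse A * inverse A'" using nz by (simp add: lam field_simps)
    have "lam * inverse B - inverse A * (m11 + m22 * inverse B) + inverse A * inverse A = 0"
      using 3 det by algebra
    then have "inverse A * (inverse A + inverse A' - (m11 + m22 * inverse B)) = 0"
      unfolding l by (simp add: algebra_simps)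
    then show ?thesis using nz by simp
  qed
  then have t2: "B * A * A' * m11 + A * A' * m22 = B * (A + A')" using nz by (simp add: field_simps)
  have tr': "A * A' * m11 + A * A' * m22 = A * A' + B" using tr nz by (simp add: lam field_simps)
  have nn: "B - 1 \<noteq> 0" "A - 1 \<noteq> 0" "A' - 1 \<noteq> 0" "A - B \<noteq> 0" "A' - B \<noteq> 0" "A * A' - B \<noteq> 0"
    using ne nz by (auto simp: lam)
  \<comment> \<open>The factors \<open>B - 1\<close> and \<open>A * A' - B\<close> show where the
    assumptions on \<open>B\<close> and \<open>lam\<close> exclude a zero denominator in
    \<open>p\<close>.\<close>
  have h1: "1 + h = (B - 1) * (A * A' - B) / (B * (A - 1) * (A' - 1))"
    using nn nz by (simp add: h divide_simps) (simp add: algebra_simps)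
  show hz: "1 + h \<noteq> 0" using nn nz by (simp add: h1)
  have pe: "p = B * (A - 1) * (A' - 1) / (A * A' * (B - 1))"
    using nn nz unfolding p h1 lam by (simp add: divide_simps)
  show "p \<noteq> 0" "h \<noteq> 0" using nn nz by (auto simp: pe h)
  have pe': "A * A' * (B - 1) * p = B * (A - 1) * (A' - 1)" using nn nz by (simp add: pe)
  have hp: "A * A' * (B - 1) * (h * p) = - ((A - B) * (A' - B))"
    using nn nz by (simp add: pe h)
  have k: "A * A' * (B - 1) \<noteq> 0" using nn nz by simp
  have "A * A' * (B - 1) * (m11 - (1 - p)) = 0" using t2 tr' pe' by algebra
  then show m11: "m11 = 1 - p" using k by simp
  have "A * A' * (B - 1) * (m22 - (1 - h * p)) = 0" using t2 tr' hp by algebra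
  then show m22: "m22 = 1 - h * p" using k by simp
  show "m12 * m21 = h * p * p" using 1 unfolding m11 m22 by (simp add: algebra_simps)
qed

section \<open>Circuit matrices\<close>

text \<open>Three function elements suffice: \<open>f\<close> before time 1/4, the solution crossing
  \<open>I\<close> until 3/4, and \<open>k\<close> afterwards. At the switching times the path is
  inside \<open>U\<close> or \<open>V\<close>, hence in both slit domains.\<close>

lemma analytic_continuation_across_slits:
  assumes \<gamma>: "continuous_on UNIV \<gamma>"
    and f: "hg_solution a b c (slit I0) f" and k: "hg_solution a b c (slit I0) k"
    and cont: "continues a b c I U V f k"
    and slits: "open (slit I0)" "connected (slit I0)" "open (slit I)" "connected (slit I)"
    and UV: "open U" "U \<subseteq> slit I0" "U \<subseteq> slit I" "open V" "V \<subseteq> slit I0" "V \<subseteq> slit I"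
    and ends: "\<gamma> 0 \<in> slit I0" "\<gamma> 1 \<in> slit I0" "\<gamma> (1/2) \<in> slit I"
    and U: "\<And>t. 0 < t \<Longrightarrow> t < 1/2 \<Longrightarrow> \<gamma> t \<in> U" and V: "\<And>t. 1/2 < t \<Longrightarrow> t < 1 \<Longrightarrow> \<gamma> t \<in> V"
  shows "analytic_continuation_along \<gamma> f k"
proof -
  obtain g where g: "hg_solution a b c (slit I) g" "\<And>x. x \<in> U \<Longrightarrow> g x = f x" "\<And>x. x \<in> V \<Longrightarrow> g x = k x"
    using cont by (auto simp: continues_def)
  define G where "G t = (if t < 1/4 then f else if t \<le> 3/4 then g else k)" for t :: real
  define D where "D t = (if t < 1/4 then slit I0 else if t \<le> 3/4 then slit I else slit I0)" for t :: real
  have near: "\<forall>\<^sub>F s in nhds t. \<gamma> s \<in> W" if "open W" "\<gamma> t \<in> W" for W t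
    using eventually_nhds_in_open[OF open_vimage[OF that(1) \<gamma>], of t] that(2) by simp
  have mem: "\<gamma> t \<in> slit I0" if "0 \<le> t" "t \<le> 1/4 \<or> 3/4 \<le> t" "t \<le> 1" for t
    using that ends U[of t] V[of t] UV by (cases "t = 0 \<or> t = 1") auto
  have mem': "\<gamma> t \<in> slit I" if "1/4 \<le> t" "t \<le> 3/4" for t
  proof -
    consider "t = 1/2" | "t < 1/2" | "1/2 < t" by linarith
    then show ?thesis
    proof cases
      case 1
      show ?thesis unfolding 1 by (rule ends(3))
    qed (use that U[of t] V[of t] UV in auto)
  qed
  have *: "\<forall>\<^sub>F s in nhds t. s \<in> {0..1} \<longrightarrow> \<gamma> s \<in> D t \<and> (\<forall>\<^sub>F x in nhds (\<gamma> s). G s x = G t x)"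
    if t: "t \<in> {0..1}" for t
  proof -
    have in_D: "\<forall>\<^sub>F s in nhds t. \<gamma> s \<in> D t"
      using mem[of t] mem'[of t] t by (intro near) (auto simp: D_def slits)
    have eqn: "\<forall>\<^sub>F x in nhds z. f x = g x" if "z \<in> U" for z
      using eventually_nhds_in_open[OF UV(1) that] by eventually_elim (simp add: g)
    have eqn': "\<forall>\<^sub>F x in nhds z. k x = g x" if "z \<in> V" for z
      using eventually_nhds_in_open[OF UV(4) that] by eventually_elim (simp add: g)
    consider "t < 1/4" | "t = 1/4" | "1/4 < t" "t < 3/4" | "t = 3/4" | "t > 3/4" by linarith
    then show ?thesis
    proof cases
      case 1
      then have near_t: "\<forall>\<^sub>F s in nhds t. s \<in> {..<1/4}" by (intro eventually_nhds_in_open) auto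
      from in_D near_t show ?thesis by eventually_elim (use 1 in \<open>auto simp: G_def\<close>)
    next
      \<comment> \<open>Different elements meet only at 1/4 and 3/4. Near 1/4 the path stays in
        \<open>U\<close>, where \<open>f\<close> and \<open>g\<close> coincide; the case of 3/4 is
        analogous with \<open>V\<close>.\<close>
      case 2
      then have near_t: "\<forall>\<^sub>F s in nhds t. s \<in> {..<3/4}" by (intro eventually_nhds_in_open) auto
      have near_U: "\<forall>\<^sub>F s in nhds t. \<gamma> s \<in> U" using 2 U[of t] UV by (intro near) auto
      have Gs: "G s = (if s < 1/4 then f else G t)" if "s < 3/4" for s
        using that 2 by (simp add: G_def)
      have Gt: "G t = g" using 2 by (simp add: G_def)
      show ?thesis using in_D near_t near_U by eventually_elim (simp add: Gs Gt eqn)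
    next
      case 3
      then have near_t: "\<forall>\<^sub>F s in nhds t. s \<in> {1/4<..<3/4}" by (intro eventually_nhds_in_open) auto
      from in_D near_t show ?thesis by eventually_elim (use 3 in \<open>auto simp: G_def\<close>)
    next
      case 4
      then have near_t: "\<forall>\<^sub>F s in nhds t. s \<in> {1/4<..}" by (intro eventually_nhds_in_open) auto
      have near_V: "\<forall>\<^sub>F s in nhds t. \<gamma> s \<in> V" using 4 V[of t] UV by (intro near) auto
      have Gs: "G s = (if s \<le> 3/4 then G t else k)" if "1/4 < s" for s
        using that 4 by (simp add: G_def)
      have Gt: "G t = g" using 4 by (simp add: G_def)
      show ?thesis using in_D near_t near_V by eventually_elim (simp add: Gs Gt eqn')
    next
      case 5
      then have near_t: "\<forall>\<^sub>F s in nhds t. s \<in> {3/4<..}" by (intro eventually_nhds_in_open) auto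
      from in_D near_t show ?thesis by eventually_elim (use 5 in \<open>auto simp: G_def\<close>)
    qed
  qed
  show ?thesis
    unfolding analytic_continuation_along_def
  proof (intro exI[of _ G] exI[of _ D] conjI ballI)
    fix t :: real assume t: "t \<in> {0..1}"
    show "open (D t)" "connected (D t)" by (simp_all add: D_def slits)
    show "\<gamma> t \<in> D t" using mem[of t] mem'[of t] t by (auto simp: D_def)
    show "G t holomorphic_on D t" using f g(1) k by (auto simp: G_def D_def hg_solution_def)
    from *[OF t] show "\<exists>\<delta>>0. \<forall>s\<in>{0..1}. \<bar>s - t\<bar> < \<delta> \<longrightarrow>
        \<gamma> s \<in> D t \<and> (\<forall>\<^sub>F x in nhds (\<gamma> s). G s x = G t x)"
      unfolding eventually_nhds_metric dist_real_def by blast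
  qed (simp_all add: G_def)
qed

section \<open>The two loops\<close>

lemma rho0_Re_Im: "Re (rho0 \<epsilon> t) = \<epsilon> * cos (2 * pi * t)" "Im (rho0 \<epsilon> t) = \<epsilon> * sin (2 * pi * t)"
  by (simp_all add: rho0_def Re_exp Im_exp)

lemma rho1_Re_Im: "Re (rho1 \<epsilon> t) = 1 - (1 - \<epsilon>) * cos (2 * pi * t)" "Im (rho1 \<epsilon> t) = - ((1 - \<epsilon>) * sin (2 * pi * t))"
  by (simp_all add: rho1_def Re_exp Im_exp)

text \<open>These signs fix the order of the half-planes: \<open>rho0\<close> passes the upper one
  first, and \<open>rho1\<close>, whose imaginary part carries a minus sign, the lower one.\<close>

lemma sin_two_pi_sign:
  "0 < t \<Longrightarrow> t < 1/2 \<Longrightarrow> 0 < sin (2 * pi * t)" "1/2 < t \<Longrightarrow> t < 1 \<Longrightarrow> sin (2 * pi * t) < 0"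
proof -
  show "0 < sin (2 * pi * t)" if "0 < t" "t < 1/2"
    using that by (intro sin_gt_zero) (auto simp: field_simps)
  show "sin (2 * pi * t) < 0" if "1/2 < t" "t < 1"
    using that by (intro sin_lt_zero) (auto simp: field_simps)
qed

lemma continuous_rho: "continuous_on A (rho0 \<epsilon>)" "continuous_on A (rho1 \<epsilon>)"
  unfolding rho0_def rho1_def by (intro continuous_intros)+

lemma rho_ends: "rho0 \<epsilon> 0 = of_real \<epsilon>" "rho0 \<epsilon> 1 = of_real \<epsilon>" "rho0 \<epsilon> (1/2) = of_real (- \<epsilon>)"
  "rho1 \<epsilon> 0 = of_real \<epsilon>" "rho1 \<epsilon> 1 = of_real \<epsilon>" "rho1 \<epsilon> (1/2) = of_real (2 - \<epsilon>)"
  by (simp_all add: complex_eq_iff rho0_Re_Im rho1_Re_Im)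

text \<open>The loops run on circles of radius \<epsilon> about 0 and \<open>1 - \<epsilon>\<close>
  about 1. Neither radius is 0 or 1, the distances of the two singular points from the
  centre.\<close>

lemma loop_in_rho:
  assumes "0 < \<epsilon>" "\<epsilon> < 1"
  shows "loop_in (UNIV - {0, 1}) (of_real \<epsilon>) (rho0 \<epsilon>)" "loop_in (UNIV - {0, 1}) (of_real \<epsilon>) (rho1 \<epsilon>)"
proof -
  have "norm (rho0 \<epsilon> t) = \<epsilon>" for t using assms by (simp add: rho0_def norm_mult)
  then have "norm (rho0 \<epsilon> t) \<noteq> norm (0 :: complex)" "norm (rho0 \<epsilon> t) \<noteq> norm (1 :: complex)" for t
    using assms by simp_all
  then have "rho0 \<epsilon> t \<noteq> 0" "rho0 \<epsilon> t \<noteq> 1" for t by metis+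
  then show "loop_in (UNIV - {0, 1}) (of_real \<epsilon>) (rho0 \<epsilon>)"
    by (auto simp: loop_in_def path_def path_image_def pathstart_def pathfinish_def rho_ends
        intro: continuous_rho)
  have "norm (1 - rho1 \<epsilon> t) = 1 - \<epsilon>" for t
  proof -
    have "1 - rho1 \<epsilon> t = of_real (1 - \<epsilon>) * exp (2 * of_real pi * \<i> * of_real t)"
      by (simp add: rho1_def)
    moreover have "norm (exp (2 * of_real pi * \<i> * of_real t)) = 1" by simp
    ultimately have "norm (1 - rho1 \<epsilon> t) = \<bar>1 - \<epsilon>\<bar> * 1" by (simp only: norm_mult norm_of_real)
    then show ?thesis using assms by simp
  qed
  then have "norm (1 - rho1 \<epsilon> t) \<noteq> norm (1 - 0 :: complex)"
    "norm (1 - rho1 \<epsilon> t) \<noteq> norm (1 - 1 :: complex)" for t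
    using assms by simp_all
  then have "rho1 \<epsilon> t \<noteq> 0" "rho1 \<epsilon> t \<noteq> 1" for t by metis+
  then show "loop_in (UNIV - {0, 1}) (of_real \<epsilon>) (rho1 \<epsilon>)"
    by (auto simp: loop_in_def path_def path_image_def pathstart_def pathfinish_def rho_ends
        intro: continuous_rho)
qed

lemma hg_fundamental_system:
  assumes f: "hg_solution a b c S f1" "hg_solution a b c S f2" and ind: "independent_on S f1 f2"
    and S: "open S" "connected S" "0 \<notin> S" "1 \<notin> S" and p: "p \<in> S"
  shows "fundamental_system_around (hypergeometric_operator a b c) p (\<lambda>x. vector [f1 x, f2 x] :: complex ^ 2)"
  unfolding fundamental_system_around_def
proof (intro conjI allI impI)
  fix i :: 2
  show "solution_around (hypergeometric_operator a b c) p (\<lambda>x. (vector [f1 x, f2 x] :: complex ^ 2) $ i)"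
    using exhaust_2[of i] f S p unfolding solution_around_def
    by (intro exI[of _ S]) (auto simp: hg_solution_def)
next
  fix d :: "complex ^ 2"
  assume "\<forall>\<^sub>F x in nhds p. (\<Sum>i\<in>UNIV. d $ i * (vector [f1 x, f2 x] :: complex ^ 2) $ i) = 0"
  then obtain W where W: "open W" "p \<in> W" "\<And>x. x \<in> W \<Longrightarrow> d $ 1 * f1 x + d $ 2 * f2 x = 0"
    by (auto simp: eventually_nhds sum_2)
  have "independent_on (W \<inter> S) f1 f2"
    by (rule independent_on_subset[OF f ind S(1,2)]) (use W p S in auto)
  then have "d $ 1 = 0 \<and> d $ 2 = 0"
    using W(3) unfolding independent_on_def by blast
  then show "d = 0" by (simp add: vec_eq_iff forall_2)
next
  fix u assume "solution_around (hypergeometric_operator a b c) p u"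
  then obtain W where W: "open W" "p \<in> W" "hg_solution a b c W u"
    by (auto simp: solution_around_def hg_solution_def)
  \<comment> \<open>\<open>W\<close> need not be connected, so it is replaced by a ball before the
    spanning property is used.\<close>
  then obtain r where r: "r > 0" "ball p r \<subseteq> W \<inter> S"
    using open_contains_ball[of "W \<inter> S"] S(1) p by blast
  obtain k l where kl: "\<And>x. x \<in> ball p r \<Longrightarrow> u x = k * f1 x + l * f2 x"
    by (rule hg_solution_span[OF f ind S, of "ball p r" u])
      (use r hg_solution_subset[OF W(3)] in auto)
  have "\<forall>\<^sub>F x in nhds p. x \<in> ball p r" using r by (intro eventually_nhds_in_open) auto
  then have "\<forall>\<^sub>F x in nhds p. u x = (\<Sum>i\<in>UNIV. (vector [k, l] :: complex ^ 2) $ i * (vector [f1 x, f2 x] :: complex ^ 2) $ i)"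
    by eventually_elim (simp add: kl sum_2)
  then show "\<exists>d :: complex ^ 2. \<forall>\<^sub>F x in nhds p. u x = (\<Sum>i\<in>UNIV. d $ i * (vector [f1 x, f2 x] :: complex ^ 2) $ i)"
    by blast
qed

lemma hg_circuit_matrix:
  fixes M :: "complex ^ 2 ^ 2"
  assumes \<gamma>: "continuous_on UNIV \<gamma>" "loop_in (UNIV - {0, 1}) (of_real \<epsilon>) \<gamma>"
    and f: "hg_solution a b c (slit {0<..<1}) f1" "hg_solution a b c (slit {0<..<1}) f2"
    and cont: "continues a b c I U V f1 (\<lambda>x. M $ 1 $ 1 * f1 x + M $ 1 $ 2 * f2 x)"
      "continues a b c I U V f2 (\<lambda>x. M $ 2 $ 1 * f1 x + M $ 2 $ 2 * f2 x)"
    and slits: "open (slit I)" "connected (slit I)"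
    and UV: "open U" "U \<subseteq> slit {0<..<1}" "U \<subseteq> slit I" "open V" "V \<subseteq> slit {0<..<1}" "V \<subseteq> slit I"
    and ends: "0 < \<epsilon>" "\<epsilon> < 1" "\<gamma> 0 = of_real \<epsilon>" "\<gamma> 1 = of_real \<epsilon>" "\<gamma> (1/2) \<in> slit I"
    and U: "\<And>t. 0 < t \<Longrightarrow> t < 1/2 \<Longrightarrow> \<gamma> t \<in> U" and V: "\<And>t. 1/2 < t \<Longrightarrow> t < 1 \<Longrightarrow> \<gamma> t \<in> V"
    and M: "M $ 1 $ 1 * M $ 2 $ 2 - M $ 1 $ 2 * M $ 2 $ 1 \<noteq> 0"
  shows "is_circuit_matrix (UNIV - {0, 1}) (of_real \<epsilon>) (\<lambda>x. vector [f1 x, f2 x]) \<gamma> M"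
  unfolding is_circuit_matrix_def
proof (intro conjI allI)
  show "invertible M" using M by (simp add: invertible_det_nz det_2)
  have *: "analytic_continuation_along \<gamma> u (\<lambda>x. r * f1 x + s * f2 x)"
    if "hg_solution a b c (slit {0<..<1}) u" "continues a b c I U V u (\<lambda>x. r * f1 x + s * f2 x)" for u r s
    by (rule analytic_continuation_across_slits[OF \<gamma>(1) that(1) hg_solution_lincomb[OF f] that(2) _ _ slits UV])
      (use ends U V in auto)
  fix i :: 2
  show "analytic_continuation_along \<gamma> (\<lambda>x. (vector [f1 x, f2 x] :: complex ^ 2) $ i) (\<lambda>x. (M *v vector [f1 x, f2 x]) $ i)"
    using exhaust_2[of i] *[OF f(1) cont(1)] *[OF f(2) cont(2)]
    by (auto simp: matrix_vector_mult_def sum_2)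
qed (fact \<gamma>(2))

theorem theorem2p1:
  fixes a1 a2 b1 A1 A2 B1 lam :: complex
    and v :: "complex ^ 2 ^ 1"
    and H :: "complex ^ 2 ^ 2"
  assumes "a1 \<notin> \<int>" and "a2 \<notin> \<int>" and "b1 \<notin> \<int>"
    and "a1 - b1 \<notin> \<int>" and "a2 - b1 \<notin> \<int>" and "a1 + a2 - b1 \<notin> \<int>"
    and "A1 = exp (2 * of_real pi * \<i> * a1)"
    and "A2 = exp (2 * of_real pi * \<i> * a2)"
    and "B1 = exp (2 * of_real pi * \<i> * b1)"
    and "lam = B1 / (A1 * A2)"
    and "v = rowvector (vector [1, 1])"
    and "H = vector [vector [1, 0],
                     vector [0, - (((A1 - B1) * (A2 - B1)) / (B1 * (A1 - 1) * (A2 - 1)))]]"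
  shows "\<forall>\<^sub>F \<epsilon> :: real in at_right 0.
    \<exists>F2 :: complex \<Rightarrow> complex ^ 2.
      fundamental_system_around (hypergeometric_operator a1 a2 b1) (of_real \<epsilon>) F2 \<and>
      is_circuit_matrix (UNIV - {0, 1}) (of_real \<epsilon>) F2 (rho0 \<epsilon>)
        (vector [vector [1, 0],
                 vector [0, inverse B1]]) \<and>
      is_circuit_matrix (UNIV - {0, 1}) (of_real \<epsilon>) F2 (rho1 \<epsilon>)
        (mat 1 - (\<chi> i j. (1 - lam) / (v ** H ** transpose v) $ 1 $ 1
                          * (H ** transpose v ** v) $ i $ j))"
proof -
  \<comment> \<open>With \<open>v\<close> consisting of ones, \<open>1 + h\<close> is the entry of
    \<open>v ** H ** transpose v\<close>.\<close>
  define h where "h = - (((A1 - B1) * (A2 - B1)) / (B1 * (A1 - 1) * (A2 - 1)))"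
  define p where "p = (1 - lam) / (1 + h)"
  have nz: "A1 \<noteq> 0" "A2 \<noteq> 0" "B1 \<noteq> 0" using assms by auto
  have inv: "exp (- (2 * of_real pi * \<i> * a1)) = inverse A1" "exp (- (2 * of_real pi * \<i> * a2)) = inverse A2"
    "exp (- (2 * of_real pi * \<i> * b1)) = inverse B1"
    using assms by (simp_all add: exp_minus)
  have L: "exp (2 * of_real pi * \<i> * (b1 - a1 - a2)) = lam"
    using assms by (simp add: right_diff_distrib exp_diff)
  have ne: "A1 \<noteq> 1" "A2 \<noteq> 1" "B1 \<noteq> 1" using assms by (simp_all add: exp_two_pi_eq_1_iff)
  have "exp (2 * of_real pi * \<i> * (a1 - b1)) \<noteq> 1" "exp (2 * of_real pi * \<i> * (a2 - b1)) \<noteq> 1"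
    "exp (2 * of_real pi * \<i> * (a1 + a2 - b1)) \<noteq> 1"
    using assms by (simp_all add: exp_two_pi_eq_1_iff)
  then have ne': "A1 \<noteq> B1" "A2 \<noteq> B1" "lam \<noteq> 1"
    using nz assms(7-10) by (auto simp: right_diff_distrib distrib_left exp_diff exp_add)
  obtain f1 f2 m11 m12 m21 m22 where
    f: "hg_solution a1 a2 b1 (slit {0<..<1}) f1" "hg_solution a1 a2 b1 (slit {0<..<1}) f2" and
    ind: "independent_on (slit {0<..<1}) f1 f2" and
    z: "continues a1 a2 b1 {..<0} UH LH f1 f1"
    "continues a1 a2 b1 {..<0} UH LH f2 (\<lambda>x. inverse B1 * f2 x)" and
    o: "continues a1 a2 b1 {1<..} LH UH f1 (\<lambda>x. m11 * f1 x + m12 * f2 x)"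
    "continues a1 a2 b1 {1<..} LH UH f2 (\<lambda>x. m21 * f1 x + m22 * f2 x)" and
    e1: "(m11 - 1) * (m22 - 1) = m12 * m21" and e2: "(m11 - lam) * (m22 - lam) = m12 * m21" and
    e3: "(m11 - inverse A1) * (m22 * inverse B1 - inverse A1) = m12 * (m21 * inverse B1) \<or>
      (m11 - inverse A2) * (m22 * inverse B1 - inverse A2) = m12 * (m21 * inverse B1)"
    by (rule hg_monodromy_equations[OF assms(3,6), unfolded inv L]) (rule that; assumption)
  \<comment> \<open>\<open>lam\<close>, \<open>h\<close> and \<open>p\<close> are symmetric in
    \<open>A1\<close> and \<open>A2\<close>, so either alternative of \<open>e3\<close> gives the
    same entries.\<close>
  have m: "m11 = 1 - p" "m22 = 1 - h * p" "m12 * m21 = h * p * p" and n: "p \<noteq> 0" "h \<noteq> 0" "1 + h \<noteq> 0"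
  proof -
    have lam': "lam = B1 / (A2 * A1)" and
      h': "h = - (((A2 - B1) * (A1 - B1)) / (B1 * (A2 - 1) * (A1 - 1)))"
      using assms(10) by (simp_all add: h_def mult_ac)
    note E = monodromy_entries[OF nz ne ne' assms(10) h_def p_def e1 e2]
      monodromy_entries[OF nz(2,1,3) ne(2,1,3) ne'(2,1,3) lam' h' p_def e1 e2]
    from e3 show "m11 = 1 - p" "m22 = 1 - h * p" "m12 * m21 = h * p * p" "p \<noteq> 0" "h \<noteq> 0" "1 + h \<noteq> 0"
      using E by blast+
  qed
  have m12: "m12 \<noteq> 0" using m(3) n by auto
  \<comment> \<open>Replacing \<open>f2\<close> by \<kappa> times \<open>f2\<close> divides
    \<open>m12\<close> by \<kappa> and multiplies \<open>m21\<close> by it. This \<kappa> makes the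
    upper right entry \<open>- p\<close>, and the invariant product forces \<open>- h * p\<close>
    for the other one. The diagonal matrix at 0 is unaffected.\<close>
  define \<kappa> where "\<kappa> = - m12 / p"
  have k: "\<kappa> \<noteq> 0" "m12 = - p * \<kappa>" "\<kappa> * m21 = - h * p"
  proof -
    show "\<kappa> \<noteq> 0" "m12 = - p * \<kappa>" using m12 n by (simp_all add: \<kappa>_def)
    have "p * (\<kappa> * m21) = p * (- h * p)" using m(3) n by (simp add: \<kappa>_def)
    then show "\<kappa> * m21 = - h * p" by (rule mult_left_cancel[OF n(1), THEN iffD1])
  qed
  define k2 where "k2 x = \<kappa> * f2 x" for x
  have k2: "hg_solution a1 a2 b1 (slit {0<..<1}) k2"
    unfolding k2_def by (rule hg_solution_cmult[OF f(2)]) simp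
  have indk: "independent_on (slit {0<..<1}) f1 k2"
    using ind k(1) unfolding independent_on_def k2_def by (metis mult.assoc mult_eq_0_iff)
  define M0 :: "complex ^ 2 ^ 2" where "M0 = vector [vector [1, 0], vector [0, inverse B1]]"
  define M1 :: "complex ^ 2 ^ 2" where "M1 = mat 1 - (\<chi> i j. (1 - lam) / (v ** H ** transpose v) $ 1 $ 1
                          * (H ** transpose v ** v) $ i $ j)"
  have M0: "M0 $ 1 $ 1 = 1" "M0 $ 1 $ 2 = 0" "M0 $ 2 $ 1 = 0" "M0 $ 2 $ 2 = inverse B1"
    by (simp_all add: M0_def)
  have M1: "M1 $ 1 $ 1 = 1 - p" "M1 $ 1 $ 2 = - p" "M1 $ 2 $ 1 = - h * p" "M1 $ 2 $ 2 = 1 - h * p"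
  proof -
    have H: "H = vector [vector [1, 0], vector [0, h]]" using assms(12) by (simp add: h_def)
    have "(v ** H ** transpose v) $ 1 $ 1 = 1 + h"
      by (simp add: assms(11) H matrix_matrix_mult_def transpose_def rowvector_def sum_2)
    then show "M1 $ 1 $ 1 = 1 - p" "M1 $ 1 $ 2 = - p" "M1 $ 2 $ 1 = - h * p" "M1 $ 2 $ 2 = 1 - h * p"
      by (simp_all add: M1_def p_def assms(11) H matrix_matrix_mult_def transpose_def rowvector_def
          sum_2 sum_1 mat_def)
  qed
  \<comment> \<open>Subtracting a matrix of rank one from the identity lowers the determinant by its
    trace \<open>p * (1 + h)\<close>, which is \<open>1 - lam\<close>.\<close>
  have det: "M1 $ 1 $ 1 * M1 $ 2 $ 2 - M1 $ 1 $ 2 * M1 $ 2 $ 1 \<noteq> 0"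
  proof -
    have "(1 - p) * (1 - h * p) - (- p) * (- h * p) = 1 - p * (1 + h)" by (simp add: algebra_simps)
    also have "\<dots> = lam" using n by (simp add: p_def)
    finally show ?thesis unfolding M1 using nz assms(10) by simp
  qed
  have z0: "continues a1 a2 b1 {..<0} UH LH f1 (\<lambda>x. M0 $ 1 $ 1 * f1 x + M0 $ 1 $ 2 * k2 x)"
    using z(1) by (simp add: M0)
  have z1: "continues a1 a2 b1 {..<0} UH LH k2 (\<lambda>x. M0 $ 2 $ 1 * f1 x + M0 $ 2 $ 2 * k2 x)"
    by (rule continues_cong[OF continues_lincomb[OF z, of 0 \<kappa>]]) (simp_all add: M0 k2_def)
  have o0: "continues a1 a2 b1 {1<..} LH UH f1 (\<lambda>x. M1 $ 1 $ 1 * f1 x + M1 $ 1 $ 2 * k2 x)"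
    by (rule continues_cong[OF o(1)]) (simp_all add: M1 k2_def m k)
  have o1: "continues a1 a2 b1 {1<..} LH UH k2 (\<lambda>x. M1 $ 2 $ 1 * f1 x + M1 $ 2 $ 2 * k2 x)"
  proof (rule continues_cong[OF continues_lincomb[OF o, of 0 \<kappa>]])
    show "M1 $ 2 $ 1 * f1 x + M1 $ 2 $ 2 * k2 x =
        0 * (m11 * f1 x + m12 * f2 x) + \<kappa> * (m21 * f1 x + m22 * f2 x)" for x
      unfolding M1 k2_def m(2) k(3)[symmetric] by (simp add: algebra_simps)
  qed (simp_all add: k2_def)
  \<comment> \<open>"Sufficiently small" means below 1, and the same pair of functions works for all
    such \<epsilon>.\<close>
  have "\<exists>F2 :: complex \<Rightarrow> complex ^ 2.
      fundamental_system_around (hypergeometric_operator a1 a2 b1) (of_real \<epsilon>) F2 \<and>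
      is_circuit_matrix (UNIV - {0, 1}) (of_real \<epsilon>) F2 (rho0 \<epsilon>) M0 \<and>
      is_circuit_matrix (UNIV - {0, 1}) (of_real \<epsilon>) F2 (rho1 \<epsilon>) M1" if \<epsilon>: "0 < \<epsilon>" "\<epsilon> < 1" for \<epsilon>
  proof (intro exI[of _ "\<lambda>x. vector [f1 x, k2 x]"] conjI)
    show "fundamental_system_around (hypergeometric_operator a1 a2 b1) (of_real \<epsilon>)
        (\<lambda>x. vector [f1 x, k2 x] :: complex ^ 2)"
      by (rule hg_fundamental_system[OF f(1) k2 indk]) (use \<epsilon> in auto)
    show "is_circuit_matrix (UNIV - {0, 1}) (of_real \<epsilon>) (\<lambda>x. vector [f1 x, k2 x]) (rho0 \<epsilon>) M0"
      by (rule hg_circuit_matrix[OF continuous_rho(1) loop_in_rho(1)[OF \<epsilon>] f(1) k2 z0 z1])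
        (use \<epsilon> nz open_connected_slits halfplanes in \<open>auto simp: rho_ends rho0_Re_Im sin_two_pi_sign mult_less_0_iff M0 slit_def\<close>)
    show "is_circuit_matrix (UNIV - {0, 1}) (of_real \<epsilon>) (\<lambda>x. vector [f1 x, k2 x]) (rho1 \<epsilon>) M1"
      by (rule hg_circuit_matrix[OF continuous_rho(2) loop_in_rho(2)[OF \<epsilon>] f(1) k2 o0 o1 _ _ _ _ _ _ _ _ _ _ _ _ _ _ _ det])
        (use \<epsilon> open_connected_slits halfplanes in \<open>auto simp: rho_ends rho1_Re_Im sin_two_pi_sign mult_less_0_iff slit_def\<close>)
  qed
  moreover have "\<forall>\<^sub>F \<epsilon> :: real in at_right 0. 0 < \<epsilon> \<and> \<epsilon> < 1"
    by (auto simp: eventually_at_right_field intro: exI[of _ 1])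
  ultimately show ?thesis
    unfolding M0_def M1_def by (auto elim: eventually_mono)
qed

end
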